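(* Let $\Omega$ be an open subset of the open unit ball, let $k$ be an (irreducible) complete Nevanlinna-Pick kernel on $\Omega$, and let $m$, $\beta:\Omega\to\mathbb B_m$ and $\delta$ be associated with $k$, i.e. $\beta$ is an injection, $\delta$ is a nowhere vanishing function on $\Omega$ and $k(z,w)=\delta(z)\overline{\delta(w)}\,\frac{1}{1-\langle\beta(z),\beta(w)\rangle}$ for all $z,w\in\Omega$. Then a function $S:\Omega\to\mathbb C$ belongs to $\mathcal M_k$ if and only if there is $G\in\mathcal M_{a_m}$ such that $S(z)=G(\beta(z))$ for all $z\in\Omega$. Furthermore, for $S\in\mathcal M_k$ and $w_0\in\Omega$, one has $S(w_0)=0$ if and only if there is $G_1\in\mathcal M^{m\times 1}_{a_m}$ such that $$S(z)=b_{\beta(w_0)}(\beta(z))\,G_1(\beta(z)),\qquad z\in\Omega.$$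
   Context: Let $m$ be a cardinal. $\mathbb C^m$ is regarded as a space of row vectors (it is to be read as $\ell^2$ when $m=\aleph_0$, and generally as $\ell^2(m)$ when $m$ is infinite), with $\langle\lambda,\mu\rangle=\lambda\mu^*$, and $\mathbb B_m$ is its open unit ball. The Drury-Arveson kernel is $a_m(\lambda,\mu)=\frac{1}{1-\langle\lambda,\mu\rangle}$ on $\mathbb B_m$. A kernel $k$ on $\Omega$ is irreducible if $k(z,w)\ne0$ for all $z,w\in\Omega$ and $k_z,k_w$ are linearly independent whenever $z\neq w$, where $k_w=k(\cdot,w)$. An irreducible kernel $k$ is a complete Nevanlinna-Pick (CNP) kernel if and only if, for some cardinal $m$, there exist an injection $\beta:\Omega\to\mathbb B_m$ and a nowhere vanishing function $\delta$ on $\Omega$ with $k(z,w)=\delta(z)\overline{\delta(w)}a_m(\beta(z),\beta(w))$; this characterization is used as the definition. "Positive kernel" means positive semidefinite kernel. For a positive kernel $k$ on $\Omega$, $\mathcal M_k^{p\times q}$ is the set of Schur multipliers: $\mathbb C^{p\times q}$-valued functions $s$ on $\Omega$ (bounded-operator-valued if $p$ or $q$ is infinite) such that $(I_p-s(z)s(w)^* )k(z,w)$ is a positive kernel on $\Omega$; $\mathcal M_k=\mathcal M_k^{1\times1}$. For $\alpha\in\mathbb B_m$, the Blaschke factor is the $\mathbb C^{1\times m}$-valued function $b_\alpha(\lambda)=\frac{(1-\langle\alpha,\alpha\rangle)^{1/2}}{1-\langle\lambda,\alpha\rangle}(\lambda-\alpha)(I_m-\alpha^*\alpha)^{-1/2}$,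 $\lambda\in\mathbb B_m$. It satisfies $\frac{1-b_\alpha(\lambda)b_\alpha(\mu)^*}{1-\langle\lambda,\mu\rangle}=\frac{1-\langle\alpha,\alpha\rangle}{(1-\langle\lambda,\alpha\rangle)(1-\langle\alpha,\mu\rangle)}$. *)

theory Defs
  imports "HOL-Analysis.Analysis"
begin

(* A cardinal m is represented by an index set J of cardinality m.  Vectors of l2(J) are
   functions that vanish outside J, so that equality of vectors is equality of functions. *)

definition l2 :: "'i set \<Rightarrow> ('i \<Rightarrow> complex) set" where
  "l2 J = {x. (\<forall>i. i \<notin> J \<longrightarrow> x i = 0) \<and> (\<lambda>i. (cmod (x i))\<^sup>2) summable_on J}"

definition l2_inner :: "'i set \<Rightarrow> ('i \<Rightarrow> complex) \<Rightarrow> ('i \<Rightarrow> complex) \<Rightarrow> complex" where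
  "l2_inner J x y = (\<Sum>\<^sub>\<infinity>i\<in>J. x i * cnj (y i))"

definition l2_norm :: "'i set \<Rightarrow> ('i \<Rightarrow> complex) \<Rightarrow> real" where
  "l2_norm J x = sqrt (\<Sum>\<^sub>\<infinity>i\<in>J. (cmod (x i))\<^sup>2)"

definition l2_ball :: "'i set \<Rightarrow> ('i \<Rightarrow> complex) set" where
  "l2_ball J = {x \<in> l2 J. l2_norm J x < 1}"

definition l2_open :: "'i set \<Rightarrow> ('i \<Rightarrow> complex) set \<Rightarrow> bool" where
  "l2_open J U \<longleftrightarrow> U \<subseteq> l2 J \<and>
     (\<forall>z\<in>U. \<exists>e>0. \<forall>w\<in>l2 J. l2_norm J (\<lambda>i. w i - z i) < e \<longrightarrow> w \<in> U)"

(* A bounded operator from l2(Q) to l2(P) (column vectors, acting from the left) is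
   identified with its matrix in the standard orthonormal bases.  Boundedness on finitely
   supported vectors already forces the rows to be square summable, so the sums in mat_vec
   and mat_mult converge absolutely for bounded operators. *)

type_synonym ('p, 'q) mat = "'p \<Rightarrow> 'q \<Rightarrow> complex"

definition mat_vec :: "'q set \<Rightarrow> ('p, 'q) mat \<Rightarrow> ('q \<Rightarrow> complex) \<Rightarrow> ('p \<Rightarrow> complex)" where
  "mat_vec Q A x = (\<lambda>i. \<Sum>\<^sub>\<infinity>j\<in>Q. A i j * x j)"

definition vec_mat :: "'p set \<Rightarrow> ('p \<Rightarrow> complex) \<Rightarrow> ('p, 'q) mat \<Rightarrow> ('q \<Rightarrow> complex)" where
  "vec_mat P x A = (\<lambda>j. \<Sum>\<^sub>\<infinity>i\<in>P. x i * A i j)"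

definition mat_mult :: "'q set \<Rightarrow> ('p, 'q) mat \<Rightarrow> ('q, 'r) mat \<Rightarrow> ('p, 'r) mat" where
  "mat_mult Q A B = (\<lambda>i l. \<Sum>\<^sub>\<infinity>j\<in>Q. A i j * B j l)"

definition mat_adj :: "('p, 'q) mat \<Rightarrow> ('q, 'p) mat" where
  "mat_adj A = (\<lambda>j i. cnj (A i j))"

definition mat_id :: "'p set \<Rightarrow> ('p, 'p) mat" where
  "mat_id P = (\<lambda>i j. if i \<in> P \<and> i = j then 1 else 0)"

definition bounded_ops :: "'p set \<Rightarrow> 'q set \<Rightarrow> ('p, 'q) mat set" where
  "bounded_ops P Q = {A. (\<forall>i j. A i j \<noteq> 0 \<longrightarrow> i \<in> P \<and> j \<in> Q) \<and>
     (\<exists>C. \<forall>x\<in>l2 Q. mat_vec Q A x \<in> l2 P \<and> l2_norm P (mat_vec Q A x) \<le> C * l2_norm Q x)}"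

definition positive_op :: "'p set \<Rightarrow> ('p, 'p) mat \<Rightarrow> bool" where
  "positive_op P A \<longleftrightarrow> A \<in> bounded_ops P P \<and>
     (\<forall>x\<in>l2 P. l2_inner P (mat_vec P A x) x \<in> \<real>\<^sub>\<ge>\<^sub>0)"

definition op_sqrt :: "'p set \<Rightarrow> ('p, 'p) mat \<Rightarrow> ('p, 'p) mat" where
  "op_sqrt P A = (THE B. positive_op P B \<and> mat_mult P B B = A)"

definition op_inverse :: "'p set \<Rightarrow> ('p, 'p) mat \<Rightarrow> ('p, 'p) mat" where
  "op_inverse P A =
     (THE B. B \<in> bounded_ops P P \<and> mat_mult P A B = mat_id P \<and> mat_mult P B A = mat_id P)"

definition positive_kernel :: "'x set \<Rightarrow> 'p set \<Rightarrow> ('x \<Rightarrow> 'x \<Rightarrow> ('p, 'p) mat) \<Rightarrow> bool" where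
  "positive_kernel \<Omega> P K \<longleftrightarrow>
     (\<forall>F x. finite F \<longrightarrow> F \<subseteq> \<Omega> \<longrightarrow> (\<forall>z\<in>F. x z \<in> l2 P) \<longrightarrow>
       (\<Sum>z\<in>F. \<Sum>w\<in>F. l2_inner P (mat_vec P (K z w) (x w)) (x z)) \<in> \<real>\<^sub>\<ge>\<^sub>0)"

definition schur_multipliers ::
    "'x set \<Rightarrow> ('x \<Rightarrow> 'x \<Rightarrow> complex) \<Rightarrow> 'p set \<Rightarrow> 'q set \<Rightarrow> ('x \<Rightarrow> ('p, 'q) mat) set" where
  "schur_multipliers \<Omega> k P Q = {s. (\<forall>z\<in>\<Omega>. s z \<in> bounded_ops P Q) \<and>
     positive_kernel \<Omega> P
       (\<lambda>z w i j. (mat_id P i j - mat_mult Q (s z) (mat_adj (s w)) i j) * k z w)}"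

(* The 1 x 1 case; the type unit serves as the one-element index set. *)
definition scalar_multipliers ::
    "'x set \<Rightarrow> ('x \<Rightarrow> 'x \<Rightarrow> complex) \<Rightarrow> ('x \<Rightarrow> complex) set" where
  "scalar_multipliers \<Omega> k =
     {s. (\<lambda>z _ _. s z) \<in> schur_multipliers \<Omega> k (UNIV :: unit set) (UNIV :: unit set)}"

definition drury_arveson :: "'i set \<Rightarrow> ('i \<Rightarrow> complex) \<Rightarrow> ('i \<Rightarrow> complex) \<Rightarrow> complex" where
  "drury_arveson J x y = 1 / (1 - l2_inner J x y)"

definition irreducible_kernel :: "'x set \<Rightarrow> ('x \<Rightarrow> 'x \<Rightarrow> complex) \<Rightarrow> bool" where
  "irreducible_kernel \<Omega> k \<longleftrightarrow>
     (\<forall>z\<in>\<Omega>. \<forall>w\<in>\<Omega>. k z w \<noteq> 0) \<and>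
     (\<forall>z\<in>\<Omega>. \<forall>w\<in>\<Omega>. z \<noteq> w \<longrightarrow>
       (\<forall>a b. (\<forall>u\<in>\<Omega>. a * k u z + b * k u w = 0) \<longrightarrow> a = 0 \<and> b = 0))"

(* k is a complete Nevanlinna-Pick kernel on \<Omega>, as witnessed by the data J, \<beta>, \<delta>.
   The data are arguments because HOL cannot quantify existentially over the type of
   the index set J, that is, over all cardinals. *)
definition cnp_kernel_with ::
    "'x set \<Rightarrow> ('x \<Rightarrow> 'x \<Rightarrow> complex) \<Rightarrow> 'i set \<Rightarrow> ('x \<Rightarrow> 'i \<Rightarrow> complex) \<Rightarrow> ('x \<Rightarrow> complex) \<Rightarrow> bool"
  where
  "cnp_kernel_with \<Omega> k J \<beta> \<delta> \<longleftrightarrow>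
     irreducible_kernel \<Omega> k \<and>
     \<beta> ` \<Omega> \<subseteq> l2_ball J \<and> inj_on \<beta> \<Omega> \<and>
     (\<forall>z\<in>\<Omega>. \<delta> z \<noteq> 0) \<and>
     (\<forall>z\<in>\<Omega>. \<forall>w\<in>\<Omega>. k z w = \<delta> z * cnj (\<delta> w) * drury_arveson J (\<beta> z) (\<beta> w))"

(* For a row vector a, the matrix a^* a has entries cnj (a i) * a j. *)
definition blaschke :: "'i set \<Rightarrow> ('i \<Rightarrow> complex) \<Rightarrow> ('i \<Rightarrow> complex) \<Rightarrow> ('i \<Rightarrow> complex)" where
  "blaschke J a x = (\<lambda>j.
     csqrt (1 - l2_inner J a a) / (1 - l2_inner J x a) *
     vec_mat J (\<lambda>i. x i - a i)
       (op_inverse J (op_sqrt J (\<lambda>i l. mat_id J i l - cnj (a i) * a l))) j)"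

end

theory Submission
  imports Defs
begin

text \<open>
  Everything rests on one interpolation theorem for the Drury-Arveson kernel \<open>a\<close>
  (lemma \<open>tangential_interpolation\<close>): given points \<open>x z\<close> of the ball, row vectors \<open>u z\<close>
  in \<open>l2 P\<close> and scalars \<open>v z\<close>, there is a contractive column multiplier \<open>G\<close> of \<open>a\<close> with
  \<open>u z * G (x z) = v z\<close> for all \<open>z\<close> as soon as the kernel
  \<open>(\<langle>u z, u w\<rangle> - v z * cnj (v w)) * a (x z) (x w)\<close> is positive.  Since the factor \<open>\<delta>\<close> does not
  affect positivity, a function \<open>S\<close> is a multiplier of \<open>k\<close> iff
  \<open>(1 - S z * cnj (S w)) * a (\<beta> z) (\<beta> w)\<close> is positive, so the case \<open>u = 1\<close>, \<open>v = S\<close> extends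
  \<open>S\<close> to a multiplier of \<open>a\<close>.  If moreover \<open>S w\<^sub>0 = 0\<close>, the Schur complement of this kernel at
  \<open>w\<^sub>0\<close> is, by the identity satisfied by the Blaschke factor \<open>b\<close> at \<open>\<beta> w\<^sub>0\<close>, exactly
  \<open>(\<langle>b z, b w\<rangle> - S z * cnj (S w)) * a (\<beta> z) (\<beta> w)\<close>, and the case \<open>u = b\<close>, \<open>v = S\<close> produces the
  factorization.  The converse directions are immediate, because positivity restricts to
  subsets and the Blaschke factor vanishes at its centre.

  The interpolation theorem is proved by extending the data one pair \<open>(y, u)\<close> at a time.  For
  finite data (\<open>pick_extension_finite\<close>) write \<open>a s t\<close> for the kernel at the points of two of
  the conditions, and split it as \<open>a s t = g s * cnj (g t) + a s t * \<langle>b s, b t\<rangle>\<close>, where \<open>b\<close> is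
  the Blaschke factor at the new point \<open>y\<close> and \<open>g s\<close> is a fixed multiple of \<open>a s y\<close>.
  The unknown value enters the kernel through the rank one term
  \<open>v s * g s * cnj (v t * g t)\<close> only, and the rest of the kernel is positive because multiplication by the Gram matrix of \<open>b\<close>
  preserves positivity.  Finding the value therefore amounts to extending a linear functional from
  a hyperplane without increasing its norm with respect to a positive semidefinite form
  (\<open>psd_rank_one_extension\<close>), which orthogonal projection achieves.  Compactness of discs removes
  the finiteness hypothesis (\<open>pick_extension\<close>), and Zorn's lemma gives data defined on all pairs
  of a point of the ball and a vector of \<open>l2 P\<close> (\<open>maximal_pick_data\<close>).
  Positivity makes the value linear and contractive in the vector, hence it is given by a column
  \<open>G y\<close>, and positivity of the whole data is the multiplier property of \<open>G\<close>.
\<close>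

section \<open>Positive semidefinite scalar kernels\<close>

text \<open>The sesquilinear form with matrix \<open>K\<close> on coefficient families supported on \<open>T\<close>: with
  \<open>K i j = \<langle>k i, k j\<rangle>\<close> it is the inner product of \<open>\<Sum>i\<in>T. c i * k i\<close> and \<open>\<Sum>j\<in>T. d j * k j\<close>.
  It is meaningful for finite \<open>T\<close>.\<close>

definition hform :: "'a set \<Rightarrow> ('a \<Rightarrow> 'a \<Rightarrow> complex) \<Rightarrow> ('a \<Rightarrow> complex) \<Rightarrow> ('a \<Rightarrow> complex) \<Rightarrow> complex" where
  "hform T K c d = (\<Sum>i\<in>T. \<Sum>j\<in>T. c i * cnj (d j) * K i j)"

text \<open>Positive semidefinite scalar kernels on \<open>I\<close>.  Over the complex numbers Hermitian symmetry
  follows from nonnegativity of the form; it is included so that nonnegativity need only be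
  stated for the real part.\<close>

definition psd :: "'a set \<Rightarrow> ('a \<Rightarrow> 'a \<Rightarrow> complex) \<Rightarrow> bool" where
  "psd I K \<longleftrightarrow> (\<forall>i\<in>I. \<forall>j\<in>I. K j i = cnj (K i j)) \<and>
     (\<forall>F c. finite F \<longrightarrow> F \<subseteq> I \<longrightarrow> 0 \<le> Re (hform F K c c))"

lemma hform_add_left:
  "hform T K (\<lambda>i. c i + c' i) d = hform T K c d + hform T K c' d"
  by (simp add: hform_def sum.distrib algebra_simps)

lemma hform_scale_left:
  "hform T K (\<lambda>i. a * c i) d = a * hform T K c d"
  by (simp add: hform_def sum_distrib_left algebra_simps)

lemma hform_commute:
  assumes "\<And>i j. i \<in> T \<Longrightarrow> j \<in> T \<Longrightarrow> K j i = cnj (K i j)"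
  shows "hform T K d c = cnj (hform T K c d)"
proof -
  have "hform T K d c = (\<Sum>j\<in>T. \<Sum>i\<in>T. d i * cnj (c j) * K i j)"
    unfolding hform_def by (rule sum.swap)
  also have "\<dots> = (\<Sum>j\<in>T. \<Sum>i\<in>T. cnj (c j * cnj (d i) * K j i))"
  proof (intro sum.cong refl)
    fix i j assume "i \<in> T" "j \<in> T"
    then have "K i j = cnj (K j i)" by (rule assms[rotated])
    then show "d i * cnj (c j) * K i j = cnj (c j * cnj (d i) * K j i)" by simp
  qed
  finally show ?thesis by (simp add: hform_def)
qed

lemma hform_add_right:
  "hform T K c (\<lambda>i. d i + d' i) = hform T K c d + hform T K c d'"
  by (simp add: hform_def sum.distrib algebra_simps)

lemma hform_scale_right:
  "hform T K c (\<lambda>i. a * d i) = cnj a * hform T K c d"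
  by (simp add: hform_def sum_distrib_left algebra_simps)

lemma hform_cong:
  assumes "\<And>i j. i \<in> T \<Longrightarrow> j \<in> T \<Longrightarrow> c i * cnj (d j) * K i j = c' i * cnj (d' j) * K' i j"
  shows "hform T K c d = hform T K' c' d'"
  using assms unfolding hform_def by (intro sum.cong refl) auto

lemma hform_restrict:
  assumes "finite T" "S \<subseteq> T" "\<And>i. i \<in> T - S \<Longrightarrow> c i = 0"
    "\<And>i. i \<in> T - S \<Longrightarrow> d i = 0"
  shows "hform T K c d = hform S K c d"
proof -
  have "hform T K c d = (\<Sum>i\<in>S. \<Sum>j\<in>T. c i * cnj (d j) * K i j)"
    unfolding hform_def using assms by (intro sum.mono_neutral_right) auto
  also have "\<dots> = (\<Sum>i\<in>S. \<Sum>j\<in>S. c i * cnj (d j) * K i j)"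
    using assms by (intro sum.cong refl sum.mono_neutral_right) auto
  finally show ?thesis by (simp add: hform_def)
qed

lemma hform_unit_right:
  assumes "finite T" "j \<in> T"
  shows "hform T K c (\<lambda>i. if i = j then 1 else 0) = (\<Sum>i\<in>T. c i * K i j)"
  unfolding hform_def using assms
  by (intro sum.cong refl) (simp add: if_distrib if_distribR sum.delta' cong: if_cong)

lemma hform_rank_one:
  "hform T (\<lambda>i j. g i * cnj (g j)) c c = of_real ((cmod (\<Sum>i\<in>T. c i * g i))\<^sup>2)"
  unfolding hform_def complex_norm_square
  by (simp add: sum_product algebra_simps)

lemma hform_diff_kernel:
  "hform T (\<lambda>i j. K i j - L i j) c c = hform T K c c - hform T L c c"
  by (simp add: hform_def sum_subtractf algebra_simps)

lemma psdI:
  assumes "\<And>i j. i \<in> I \<Longrightarrow> j \<in> I \<Longrightarrow> K j i = cnj (K i j)"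
    "\<And>F c. finite F \<Longrightarrow> F \<subseteq> I \<Longrightarrow> 0 \<le> Re (hform F K c c)"
  shows "psd I K"
  unfolding psd_def using assms by blast

lemma psd_hermitian: "psd I K \<Longrightarrow> i \<in> I \<Longrightarrow> j \<in> I \<Longrightarrow> K j i = cnj (K i j)"
  unfolding psd_def by blast

lemma psd_nonneg: "psd I K \<Longrightarrow> finite F \<Longrightarrow> F \<subseteq> I \<Longrightarrow> 0 \<le> Re (hform F K c c)"
  unfolding psd_def by blast

lemma psd_mono: "psd I K \<Longrightarrow> I' \<subseteq> I \<Longrightarrow> psd I' K"
  unfolding psd_def by (meson subset_trans subsetD)

lemma psd_cong:
  assumes K: "psd I K" and "\<And>i j. i \<in> I \<Longrightarrow> j \<in> I \<Longrightarrow> K i j = L i j"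
  shows "psd I L"
proof (rule psdI)
  fix i j assume "i \<in> I" "j \<in> I"
  then show "L j i = cnj (L i j)"
    using assms(2)[of i j] assms(2)[of j i] psd_hermitian[OF K, of i j] by simp
next
  fix F c assume F: "finite F" "F \<subseteq> I"
  have "hform F L c c = hform F K c c"
    using assms(2) F(2) by (intro hform_cong) (simp add: subset_iff)
  then show "0 \<le> Re (hform F L c c)" using psd_nonneg[OF K F] by simp
qed

lemma psd_finite_iff: "psd I K \<longleftrightarrow> (\<forall>F. finite F \<longrightarrow> F \<subseteq> I \<longrightarrow> psd F K)"
proof (intro iffI psdI)
  fix i j assume *: "\<forall>F. finite F \<longrightarrow> F \<subseteq> I \<longrightarrow> psd F K" and "i \<in> I" "j \<in> I"
  then have "psd {i, j} K" by auto
  then show "K j i = cnj (K i j)" by (rule psd_hermitian) auto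
next
  fix F c assume *: "\<forall>F. finite F \<longrightarrow> F \<subseteq> I \<longrightarrow> psd F K" "finite F" "F \<subseteq> I"
  then show "0 \<le> Re (hform F K c c)" by (intro psd_nonneg[of F]) auto
qed (auto intro: psd_mono)

text \<open>The map \<open>f\<close> need not be injective: coefficients over the same point are added.\<close>

lemma psd_reindex:
  assumes "psd I K" "f ` A \<subseteq> I"
  shows "psd A (\<lambda>i j. K (f i) (f j))"
proof (rule psdI)
  fix F and c :: "_ \<Rightarrow> complex" assume F: "finite F" "F \<subseteq> A"
  define c' where "c' y = (\<Sum>i | i \<in> F \<and> f i = y. c i)" for y
  have "hform F (\<lambda>i j. K (f i) (f j)) c c =
      (\<Sum>x\<in>f ` F. \<Sum>i | i \<in> F \<and> f i = x. \<Sum>y\<in>f ` F. \<Sum>j | j \<in> F \<and> f j = y.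
         c i * cnj (c j) * K (f i) (f j))"
    unfolding hform_def
    by (subst sum.image_gen[OF F(1), where g = f], intro sum.cong refl,
        subst sum.image_gen[OF F(1), where g = f], rule refl)
  also have "\<dots> = (\<Sum>x\<in>f ` F. \<Sum>y\<in>f ` F. \<Sum>i | i \<in> F \<and> f i = x. \<Sum>j | j \<in> F \<and> f j = y.
         c i * cnj (c j) * K x y)"
    by (rule sum.cong[OF refl], subst sum.swap, intro sum.cong refl) auto
  also have "\<dots> = hform (f ` F) K c' c'"
    unfolding hform_def c'_def
    by (simp only: cnj_sum sum_product) (simp only: sum_distrib_right)
  finally show "0 \<le> Re (hform F (\<lambda>i j. K (f i) (f j)) c c)"
    using psd_nonneg[OF assms(1), of "f ` F"] F assms(2) by auto
qed (use assms in \<open>blast intro: psd_hermitian\<close>)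

lemma psd_scale:
  assumes "psd I K"
  shows "psd I (\<lambda>i j. g i * cnj (g j) * K i j)"
proof (rule psdI)
  fix F c assume F: "finite F" "F \<subseteq> I"
  have "hform F (\<lambda>i j. g i * cnj (g j) * K i j) c c = hform F K (\<lambda>i. c i * g i) (\<lambda>i. c i * g i)"
    by (intro hform_cong) (simp add: algebra_simps)
  then show "0 \<le> Re (hform F (\<lambda>i j. g i * cnj (g j) * K i j) c c)"
    using psd_nonneg[OF assms F] by simp
next
  fix i j assume "i \<in> I" "j \<in> I"
  then show "g j * cnj (g i) * K j i = cnj (g i * cnj (g j) * K i j)"
    using psd_hermitian[OF assms, of i j] by simp
qed

lemma psd_one: "psd I (\<lambda>_ _. 1)"
proof (rule psdI)
  fix F and c :: "'a \<Rightarrow> complex"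
  show "0 \<le> Re (hform F (\<lambda>_ _. 1) c c)"
    using hform_rank_one[of F "\<lambda>_. 1" c] by simp
qed simp

lemma psd_add:
  assumes "psd I K" "psd I L"
  shows "psd I (\<lambda>i j. K i j + L i j)"
proof (rule psdI)
  fix i j assume "i \<in> I" "j \<in> I"
  then show "K j i + L j i = cnj (K i j + L i j)"
    using assms by (simp add: psd_hermitian[of I _ i j])
next
  fix F c assume F: "finite F" "F \<subseteq> I"
  have "hform F (\<lambda>i j. K i j + L i j) c c = hform F K c c + hform F L c c"
    by (simp add: hform_def sum.distrib algebra_simps)
  then show "0 \<le> Re (hform F (\<lambda>i j. K i j + L i j) c c)"
    using psd_nonneg[OF assms(1) F, of c] psd_nonneg[OF assms(2) F, of c] by simp
qed

lemma psd_extend_zero: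
  assumes "psd I K" "\<And>i j. i \<in> I' - I \<Longrightarrow> j \<in> I' \<Longrightarrow> K i j = 0"
    "\<And>i j. i \<in> I' \<Longrightarrow> j \<in> I' - I \<Longrightarrow> K i j = 0"
  shows "psd I' K"
proof (rule psdI)
  fix i j assume "i \<in> I'" "j \<in> I'"
  then show "K j i = cnj (K i j)"
    using assms psd_hermitian[OF assms(1), of i j] by (cases "i \<in> I"; cases "j \<in> I") auto
next
  fix F c assume F: "finite F" "F \<subseteq> I'"
  have "hform F K c c = hform F K (\<lambda>i. if i \<in> I then c i else 0) (\<lambda>i. if i \<in> I then c i else 0)"
  proof (rule hform_cong)
    fix i j assume "i \<in> F" "j \<in> F"
    then have "i \<in> I' - I \<or> j \<in> I' - I \<Longrightarrow> K i j = 0" using F assms(2,3) by blast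
    then show "c i * cnj (c j) * K i j =
        (if i \<in> I then c i else 0) * cnj (if j \<in> I then c j else 0) * K i j"
      using F \<open>i \<in> F\<close> \<open>j \<in> F\<close> by (cases "i \<in> I"; cases "j \<in> I") auto
  qed
  also have "\<dots> = hform (F \<inter> I) K (\<lambda>i. if i \<in> I then c i else 0) (\<lambda>i. if i \<in> I then c i else 0)"
    using F by (intro hform_restrict) auto
  finally show "0 \<le> Re (hform F K c c)" using psd_nonneg[OF assms(1), of "F \<inter> I"] F by auto
qed

lemma hform_self_real:
  assumes "psd T K" 
  shows "hform T K c c = of_real (Re (hform T K c c))"
proof -
  have "hform T K c c = cnj (hform T K c c)"
    by (rule hform_commute) (rule psd_hermitian[OF assms])
  then show ?thesis by (metis Reals_cnj_iff of_real_Re)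
qed

text \<open>The degenerate case of the Cauchy-Schwarz inequality: a null vector of a positive
  semidefinite form is orthogonal to everything.\<close>

lemma hform_null_orthogonal:
  assumes "finite T" "psd T K" "hform T K f f = 0"
  shows "hform T K w f = 0"
proof (rule ccontr)
  define z where "z = hform T K w f"
  define W where "W = Re (hform T K w w)"
  assume "hform T K w f \<noteq> 0"
  then have z: "z \<noteq> 0" by (simp add: z_def)
  have zc: "hform T K f w = cnj z"
    unfolding z_def by (rule hform_commute) (rule psd_hermitian[OF assms(2)])
  \<comment> \<open>the form at \<open>w + a * f\<close> is then \<open>W - 2 * (W + 1) < 0\<close>\<close>
  define r where "r = (W + 1) / (cmod z)\<^sup>2"
  define a where "a = - of_real r * z"
  have "hform T K (\<lambda>i. w i + a * f i) (\<lambda>i. w i + a * f i) =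
     hform T K w w + cnj a * z + a * cnj z"
    using assms(3) zc
    by (simp add: hform_add_left hform_add_right hform_scale_left hform_scale_right z_def)
  also have "hform T K w w + cnj a * z + a * cnj z = hform T K w w + of_real (- 2 * (W + 1))"
  proof -
    have "cnj a * z + a * cnj z = - 2 * of_real r * (z * cnj z)"
      by (simp add: a_def)
    also have "\<dots> = of_real (- 2 * r * (cmod z)\<^sup>2)"
      unfolding complex_norm_square[symmetric] by simp
    also have "- 2 * r * (cmod z)\<^sup>2 = - 2 * (W + 1)" using z by (simp add: r_def)
    finally show ?thesis by (simp add: add.assoc)
  qed
  finally have "0 \<le> W - 2 * (W + 1)"
    using psd_nonneg[OF assms(2,1) order_refl, of "\<lambda>i. w i + a * f i"] by (simp add: W_def)
  moreover have "0 \<le> W" unfolding W_def using assms by (intro psd_nonneg) auto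
  ultimately show False by simp
qed

section \<open>Orthogonal projection and extension of functionals\<close>

lemma hform_expand_right:
  assumes "finite T"
  shows "hform T K g d = (\<Sum>k\<in>T. cnj (d k) * hform T K g (\<lambda>i. if i = k then 1 else 0))"
proof -
  have "hform T K g d = (\<Sum>k\<in>T. \<Sum>i\<in>T. g i * cnj (d k) * K i k)"
    unfolding hform_def by (rule sum.swap)
  also have "\<dots> = (\<Sum>k\<in>T. cnj (d k) * (\<Sum>i\<in>T. g i * K i k))"
    by (intro sum.cong refl) (simp add: sum_distrib_left mult_ac)
  finally show ?thesis using assms by (simp add: hform_unit_right)
qed

text \<open>Every vector \<open>w\<close> can be corrected by a vector supported on \<open>I\<close> so as to become
  orthogonal to all unit vectors with index in \<open>I\<close>.  The form may be degenerate, so the projection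
  is built by the Gram-Schmidt process, skipping directions that are null.\<close>

lemma psd_orthogonal_projection:
  assumes T: "finite T" "psd T K" and "I \<subseteq> T"
  shows "\<exists>c. (\<forall>i. i \<notin> I \<longrightarrow> c i = 0) \<and>
     (\<forall>j\<in>I. hform T K (\<lambda>i. w i + c i) (\<lambda>i. if i = j then 1 else 0) = 0)"
proof -
  define e where "e j = (\<lambda>i. if i = j then 1 else 0 :: complex)" for j :: 'a
  have "finite I" using assms finite_subset by auto
  then have "\<forall>w. \<exists>c. (\<forall>i. i \<notin> I \<longrightarrow> c i = 0) \<and> (\<forall>j\<in>I. hform T K (\<lambda>i. w i + c i) (e j) = 0)"
    using \<open>I \<subseteq> T\<close>
  proof (induction I rule: finite_induct)
    case empty
    then show ?case by auto
  next
    case (insert j I)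
    have orth: "hform T K g d = 0"
      if "\<forall>i. i \<notin> I \<longrightarrow> d i = 0" "\<forall>i\<in>I. hform T K g (e i) = 0" for g d
    proof -
      have "hform T K g d = (\<Sum>k\<in>T. cnj (d k) * hform T K g (e k))"
        unfolding e_def by (rule hform_expand_right) fact
      also have "\<dots> = 0" using that by (intro sum.neutral) (metis complex_cnj_zero mult_eq_0_iff)
      finally show ?thesis .
    qed
    have IH: "\<forall>w. \<exists>c. (\<forall>i. i \<notin> I \<longrightarrow> c i = 0) \<and> (\<forall>j\<in>I. hform T K (\<lambda>i. w i + c i) (e j) = 0)"
      using insert.IH insert.prems by simp
    from IH[THEN spec, of "e j"] obtain d where d: "\<forall>i. i \<notin> I \<longrightarrow> d i = 0" "\<forall>i\<in>I. hform T K (\<lambda>l. e j l + d l) (e i) = 0"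
      by blast
    define f where "f = (\<lambda>l. e j l + d l)"
    show ?case
    proof
      fix w
      from IH[THEN spec, of w] obtain c where c: "\<forall>i. i \<notin> I \<longrightarrow> c i = 0" "\<forall>i\<in>I. hform T K (\<lambda>l. w l + c l) (e i) = 0"
        by blast
      define \<mu> where "\<mu> = hform T K (\<lambda>l. w l + c l) f / hform T K f f"
      define c' where "c' l = c l + (- \<mu>) * f l" for l
      have split: "hform T K (\<lambda>l. w l + c' l) g = hform T K (\<lambda>l. w l + c l) g + (- \<mu>) * hform T K f g" for g
        unfolding c'_def by (simp only: hform_add_left hform_scale_left add.assoc)
      have "hform T K (\<lambda>l. w l + c l) f = 0" if "hform T K f f = 0"
        using hform_null_orthogonal[OF T that] .
      then have f: "hform T K (\<lambda>l. w l + c' l) f = 0"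
        unfolding split \<mu>_def by (cases "hform T K f f = 0") auto
      have I: "hform T K (\<lambda>l. w l + c' l) (e i) = 0" if "i \<in> I" for i
        using c(2) d(2) that unfolding split f_def by simp
      have "hform T K (\<lambda>l. w l + c' l) (e j) = 0"
        using f orth[OF d(1)] I unfolding f_def hform_add_right by auto
      moreover have "\<forall>i. i \<notin> insert j I \<longrightarrow> c' i = 0"
        using c(1) d(1) by (auto simp: c'_def f_def e_def)
      ultimately show "\<exists>c. (\<forall>i. i \<notin> insert j I \<longrightarrow> c i = 0) \<and>
          (\<forall>j\<in>insert j I. hform T K (\<lambda>i. w i + c i) (e j) = 0)"
        using I by blast
    qed
  qed
  then show ?thesis by (simp add: e_def)
qed

text \<open>A functional \<open>c \<mapsto> \<Sum>i. c i * L i\<close> dominated by the form of \<open>N\<close> on the coordinates in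
  \<open>I\<close> extends to the additional coordinate \<open>q\<close> with the same bound: it is extended by zero to the
  vector \<open>f\<close> that differs from the unit vector at \<open>q\<close> by a vector supported on \<open>I\<close> and is
  orthogonal to the coordinates in \<open>I\<close>.\<close>

lemma psd_rank_one_extension:
  assumes "finite I" "q \<notin> I" and N: "psd (insert q I) N"
    and L: "psd I (\<lambda>i j. N i j - L i * cnj (L j))"
  shows "\<exists>v. psd (insert q I) (\<lambda>i j. N i j - (L(q := v)) i * cnj ((L(q := v)) j))"
proof -
  define T where "T = insert q I"
  have fT: "finite T" and NT: "psd T N" using assms by (auto simp: T_def)
  define e where "e j = (\<lambda>i. if i = j then 1 else 0 :: complex)" for j :: 'a
  obtain c0 where c0: "\<forall>i. i \<notin> I \<longrightarrow> c0 i = 0"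
      "\<forall>j\<in>I. hform T N (\<lambda>i. e q i + c0 i) (e j) = 0"
    using psd_orthogonal_projection[OF fT NT, of I "e q"] by (auto simp: T_def e_def)
  define f where "f i = e q i + c0 i" for i
  \<comment> \<open>this value makes the extended functional vanish at \<open>f\<close>\<close>
  define v where "v = - (\<Sum>i\<in>I. c0 i * L i)"
  define L' where "L' = L(q := v)"
  have main: "0 \<le> Re (hform T (\<lambda>i j. N i j - L' i * cnj (L' j)) c c)" for c
  proof -
    define c' where "c' i = c i + (- c q) * f i" for i
    have c': "c' i = 0" if "i \<in> T - I" for i
      using that c0(1) \<open>q \<notin> I\<close> by (auto simp: c'_def f_def T_def e_def)
    have fc: "hform T N f c' = 0"
    proof -
      have "hform T N f c' = (\<Sum>k\<in>T. cnj (c' k) * hform T N f (e k))"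
        unfolding e_def by (rule hform_expand_right) fact
      also have "\<dots> = 0"
      proof (rule sum.neutral, rule ballI)
        fix k assume "k \<in> T"
        show "cnj (c' k) * hform T N f (e k) = 0"
          using c'[of k] c0(2) \<open>k \<in> T\<close> unfolding f_def by (cases "k \<in> I") auto
      qed
      finally show ?thesis .
    qed
    have cf: "hform T N c' f = 0"
    proof -
      have "hform T N c' f = cnj (hform T N f c')"
        by (rule hform_commute) (rule psd_hermitian[OF NT])
      then show ?thesis using fc by simp
    qed
    have c_eq: "c = (\<lambda>i. c' i + c q * f i)" by (auto simp: c'_def)
    have "hform T N c c = hform T N c' c' + c q * cnj (c q) * hform T N f f"
      by (subst (1 2) c_eq)
        (simp add: hform_add_left hform_add_right hform_scale_left hform_scale_right fc cf)
    also have "c q * cnj (c q) * hform T N f f = of_real ((cmod (c q))\<^sup>2 * Re (hform T N f f))"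
      by (metis hform_self_real[OF NT, of f] complex_norm_square of_real_mult)
    finally have "Re (hform T N c c) = Re (hform T N c' c') + (cmod (c q))\<^sup>2 * Re (hform T N f f)"
      by simp
    then have "Re (hform T N c c) \<ge> Re (hform T N c' c')"
      using psd_nonneg[OF NT fT order_refl, of f] by simp
    also have "hform T N c' c' = hform I N c' c'"
      using c' fT by (intro hform_restrict) (auto simp: T_def)
    also have "Re (hform I N c' c') \<ge> (cmod (\<Sum>i\<in>I. c' i * L i))\<^sup>2"
      using psd_nonneg[OF L assms(1) order_refl, of c'] unfolding hform_diff_kernel hform_rank_one by simp
    also have "(\<Sum>i\<in>I. c' i * L i) = (\<Sum>i\<in>T. c i * L' i)"
    proof -
      have "(\<Sum>i\<in>I. c' i * L i) = (\<Sum>i\<in>I. c i * L i) - c q * (\<Sum>i\<in>I. c0 i * L i)"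
        using \<open>q \<notin> I\<close>
        by (auto simp: c'_def f_def e_def sum_subtractf sum_distrib_left algebra_simps intro!: sum.cong
              simp flip: sum.distrib)
      also have "\<dots> = (\<Sum>i\<in>I. c i * L' i) + c q * v"
        using \<open>q \<notin> I\<close> by (auto simp: v_def L'_def intro!: sum.cong)
      finally show ?thesis using assms(1,2) by (simp add: T_def L'_def)
    qed
    finally show ?thesis unfolding hform_diff_kernel hform_rank_one by simp
  qed
  have "psd T (\<lambda>i j. N i j - L' i * cnj (L' j))"
  proof (rule psdI)
    fix F and c :: "'a \<Rightarrow> complex" assume "finite F" "F \<subseteq> T"
    define c' where "c' i = (if i \<in> F then c i else 0)" for i
    have "hform F (\<lambda>i j. N i j - L' i * cnj (L' j)) c c = hform F (\<lambda>i j. N i j - L' i * cnj (L' j)) c' c'"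
      by (intro hform_cong) (auto simp: c'_def)
    also have "\<dots> = hform T (\<lambda>i j. N i j - L' i * cnj (L' j)) c' c'"
      using \<open>F \<subseteq> T\<close> fT by (intro hform_restrict[symmetric]) (auto simp: c'_def)
    finally show "0 \<le> Re (hform F (\<lambda>i j. N i j - L' i * cnj (L' j)) c c)" using main by simp
  next
    fix i j assume "i \<in> T" "j \<in> T"
    then show "N j i - L' j * cnj (L' i) = cnj (N i j - L' i * cnj (L' j))"
      using psd_hermitian[OF NT, of i j] by simp
  qed
  then show ?thesis unfolding T_def L'_def by blast
qed

lemma psd_schur_complement:
  assumes K: "psd I K" "q \<in> I" "K q q \<noteq> 0"
  shows "psd I (\<lambda>i j. K i j - K i q * K q j / K q q)"
proof (rule psdI)
  fix i j assume "i \<in> I" "j \<in> I"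
  then show "K j i - K j q * K q i / K q q = cnj (K i j - K i q * K q j / K q q)"
    using psd_hermitian[OF K(1), of i j] psd_hermitian[OF K(1), of i q]
      psd_hermitian[OF K(1), of q j] psd_hermitian[OF K(1) K(2) K(2), symmetric] K(2)
    by (simp add: mult.commute)
next
  fix F and c :: "'a \<Rightarrow> complex" assume F: "finite F" "F \<subseteq> I"
  define T where "T = insert q F"
  have T: "finite T" "psd T K" using F K psd_mono[of I K T] by (auto simp: T_def)
  define e where "e i = (if i = q then 1 else 0 :: complex)" for i
  define d where "d i = (if i \<in> F then c i else 0)" for i
  define z where "z = hform T K d e"
  have z: "z = (\<Sum>i\<in>F. c i * K i q)"
  proof -
    have "z = (\<Sum>i\<in>T. d i * K i q)"
      unfolding z_def e_def using T by (intro hform_unit_right) (auto simp: T_def)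
    also have "\<dots> = (\<Sum>i\<in>F. c i * K i q)"
      unfolding d_def using F by (intro sum.mono_neutral_cong_right) (auto simp: T_def)
    finally show ?thesis .
  qed
  have ed: "hform T K e d = cnj z"
    unfolding z_def by (rule hform_commute) (rule psd_hermitian[OF T(2)])
  have ee: "hform T K e e = K q q"
    unfolding e_def using T by (subst hform_unit_right) (auto simp: T_def if_distrib if_distribR sum.delta cong: if_cong)
  have rK: "cnj (K q q) = K q q" using psd_hermitian[OF K(1)] K(2) by metis
  \<comment> \<open>subtract the projection of the vector onto the direction of \<open>q\<close>\<close>
  define a where "a = - z / K q q"
  have "0 \<le> Re (hform T K (\<lambda>i. d i + a * e i) (\<lambda>i. d i + a * e i))"
    using psd_nonneg[OF T(2,1)] by blast
  also have "hform T K (\<lambda>i. d i + a * e i) (\<lambda>i. d i + a * e i) = hform T K d d - z * cnj z / K q q"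
    unfolding hform_add_left hform_add_right hform_scale_left hform_scale_right ed ee z_def[symmetric] a_def
    using K(3) rK by (simp add: field_simps)
  also have "hform T K d d = hform F K d d"
    using T by (intro hform_restrict) (auto simp: T_def d_def)
  also have "hform F K d d = hform F K c c" by (intro hform_cong) (auto simp: d_def)
  also have "z * cnj z / K q q = hform F (\<lambda>i j. K i q * K q j / K q q) c c"
  proof -
    have "cnj (K j q) = K q j" if "j \<in> F" for j
      using psd_hermitian[OF K(1), of j q] K(2) F that by auto
    then have "cnj z = (\<Sum>j\<in>F. cnj (c j) * K q j)" unfolding z by (auto intro!: sum.cong)
    then show ?thesis unfolding z hform_def
      by (simp add: sum_product sum_divide_distrib algebra_simps)
  qed
  finally show "0 \<le> Re (hform F (\<lambda>i j. K i j - K i q * K q j / K q q) c c)"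
    by (simp add: hform_diff_kernel)
qed

section \<open>The spaces of square summable families\<close>

lemma l2_eq_0: "x \<in> l2 J \<Longrightarrow> i \<notin> J \<Longrightarrow> x i = 0"
  by (auto simp: l2_def)

lemma l2_cnj: "x \<in> l2 J \<Longrightarrow> (\<lambda>i. cnj (x i)) \<in> l2 J"
  by (auto simp: l2_def)

lemma l2_cnj_iff [simp]: "(\<lambda>i. cnj (x i)) \<in> l2 J \<longleftrightarrow> x \<in> l2 J"
  using l2_cnj[of x J] l2_cnj[of "\<lambda>i. cnj (x i)" J] by auto

lemma l2_scale: "x \<in> l2 J \<Longrightarrow> (\<lambda>i. a * x i) \<in> l2 J"
  by (auto simp: l2_def norm_mult power_mult_distrib intro: summable_on_cmult_right)

lemma sq_norm_add_le: "(cmod (x + y))\<^sup>2 \<le> 2 * (cmod x)\<^sup>2 + 2 * (cmod y)\<^sup>2"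
proof -
  have "(cmod (x + y))\<^sup>2 \<le> (cmod x + cmod y)\<^sup>2"
    by (intro power_mono norm_triangle_ineq norm_ge_zero)
  also have "\<dots> \<le> 2 * (cmod x)\<^sup>2 + 2 * (cmod y)\<^sup>2"
    using sum_squares_ge_zero[of "cmod x - cmod y" 0] by (simp add: power2_eq_square algebra_simps)
  finally show ?thesis .
qed

lemma l2_add:
  assumes "x \<in> l2 J" "y \<in> l2 J"
  shows "(\<lambda>i. x i + y i) \<in> l2 J"
proof -
  have "(\<lambda>i. 2 * (cmod (x i))\<^sup>2 + 2 * (cmod (y i))\<^sup>2) summable_on J"
    using assms by (intro summable_on_add summable_on_cmult_right) (auto simp: l2_def)
  then have "(\<lambda>i. (cmod (x i + y i))\<^sup>2) summable_on J"
    by (rule summable_on_comparison_test) (auto intro: sq_norm_add_le)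
  then show ?thesis using assms by (auto simp: l2_def)
qed

lemma l2_diff:
  assumes "x \<in> l2 J" "y \<in> l2 J"
  shows "(\<lambda>i. x i - y i) \<in> l2 J"
  using l2_add[OF assms(1) l2_scale[OF assms(2), of "-1"]] by simp

lemma l2_zero [simp]: "(\<lambda>_. 0) \<in> l2 J"
  by (simp add: l2_def)

lemma l2_sum:
  assumes "\<And>i. i \<in> A \<Longrightarrow> u i \<in> l2 J"
  shows "(\<lambda>p. \<Sum>i\<in>A. u i p) \<in> l2 J"
  using assms by (induction A rule: infinite_finite_induct) (auto intro: l2_add)

lemma l2_finite_support:
  assumes "finite A" "A \<subseteq> J" "\<And>i. i \<notin> A \<Longrightarrow> x i = 0"
  shows "x \<in> l2 J"
proof -
  have "(\<lambda>i. (cmod (x i))\<^sup>2) summable_on J \<longleftrightarrow> (\<lambda>i. (cmod (x i))\<^sup>2) summable_on A"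
    using assms by (intro summable_on_cong_neutral) auto
  then show ?thesis using assms by (auto simp: l2_def)
qed

lemma l2_mult_abs_summable:
  assumes "x \<in> l2 J" "y \<in> l2 J"
  shows "(\<lambda>i. norm (x i * y i)) summable_on J"
proof -
  have "(\<lambda>i. (cmod (x i))\<^sup>2 + (cmod (y i))\<^sup>2) summable_on J"
    using assms by (intro summable_on_add) (auto simp: l2_def)
  then show ?thesis
  proof (rule summable_on_comparison_test)
    fix i
    show "norm (x i * y i) \<le> (cmod (x i))\<^sup>2 + (cmod (y i))\<^sup>2"
      using sum_squares_bound[of "cmod (x i)" "cmod (y i)"]
        mult_nonneg_nonneg[OF norm_ge_zero[of "x i"] norm_ge_zero[of "y i"]]
      unfolding norm_mult by linarith
  qed auto
qed

lemma l2_mult_summable: "x \<in> l2 J \<Longrightarrow> y \<in> l2 J \<Longrightarrow> (\<lambda>i. x i * y i) summable_on J"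
  by (rule abs_summable_summable[OF l2_mult_abs_summable])

lemma l2_inner_has_sum:
  "x \<in> l2 J \<Longrightarrow> y \<in> l2 J \<Longrightarrow> ((\<lambda>i. x i * cnj (y i)) has_sum l2_inner J x y) J"
  unfolding l2_inner_def by (intro has_sum_infsum l2_mult_summable) (auto intro: l2_cnj)

lemma l2_inner_commute: "l2_inner J y x = cnj (l2_inner J x y)"
  unfolding l2_inner_def infsum_cnj[symmetric] by (simp add: mult.commute)

lemma l2_inner_add_left:
  assumes "x \<in> l2 J" "y \<in> l2 J" "z \<in> l2 J"
  shows "l2_inner J (\<lambda>i. x i + y i) z = l2_inner J x z + l2_inner J y z"
  using has_sum_add[OF l2_inner_has_sum[OF assms(1,3)] l2_inner_has_sum[OF assms(2,3)]]
  unfolding l2_inner_def by (intro infsumI) (simp add: algebra_simps)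

lemma l2_inner_scale_left: "l2_inner J (\<lambda>i. a * x i) z = a * l2_inner J x z"
  unfolding l2_inner_def by (simp add: mult.assoc infsum_cmult_right')

lemma l2_inner_scale_right: "l2_inner J z (\<lambda>i. a * x i) = cnj a * l2_inner J z x"
  unfolding l2_inner_def by (simp add: mult.left_commute infsum_cmult_right')

lemma l2_inner_diff_left:
  assumes "x \<in> l2 J" "y \<in> l2 J" "z \<in> l2 J"
  shows "l2_inner J (\<lambda>i. x i - y i) z = l2_inner J x z - l2_inner J y z"
  using l2_inner_add_left[OF assms(1) l2_scale[OF assms(2), of "-1"] assms(3)]
    l2_inner_scale_left[of J "-1" y z] by simp

lemma l2_inner_add_right:
  assumes "x \<in> l2 J" "y \<in> l2 J" "z \<in> l2 J"
  shows "l2_inner J z (\<lambda>i. x i + y i) = l2_inner J z x + l2_inner J z y"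
  using l2_inner_add_left[OF assms] by (simp add: l2_inner_commute[of J z])

lemma l2_inner_diff_right:
  assumes "x \<in> l2 J" "y \<in> l2 J" "z \<in> l2 J"
  shows "l2_inner J z (\<lambda>i. x i - y i) = l2_inner J z x - l2_inner J z y"
  using l2_inner_diff_left[OF assms] by (simp add: l2_inner_commute[of J z])

lemma l2_norm_nonneg [simp]: "0 \<le> l2_norm J x"
  unfolding l2_norm_def by (simp add: infsum_nonneg)

lemma l2_norm_sq: "(l2_norm J x)\<^sup>2 = (\<Sum>\<^sub>\<infinity>i\<in>J. (cmod (x i))\<^sup>2)"
  unfolding l2_norm_def by (simp add: infsum_nonneg)

lemma l2_norm_has_sum: "x \<in> l2 J \<Longrightarrow> ((\<lambda>i. (cmod (x i))\<^sup>2) has_sum (l2_norm J x)\<^sup>2) J"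
  unfolding l2_norm_sq by (intro has_sum_infsum) (auto simp: l2_def)

lemma l2_norm_cnj [simp]: "l2_norm J (\<lambda>i. cnj (x i)) = l2_norm J x"
  by (simp add: l2_norm_def)

lemma l2_norm_scale: "l2_norm J (\<lambda>i. a * x i) = cmod a * l2_norm J x"
  unfolding l2_norm_def
  by (simp add: norm_mult power_mult_distrib infsum_cmult_right' real_sqrt_mult)

lemma l2_inner_self:
  assumes "x \<in> l2 J"
  shows "l2_inner J x x = of_real ((l2_norm J x)\<^sup>2)"
  using has_sum_of_real[OF l2_norm_has_sum[OF assms], where 'a = complex]
  unfolding l2_inner_def complex_norm_square by (rule infsumI)

lemma l2_norm_eq_0_iff:
  assumes "x \<in> l2 J"
  shows "l2_norm J x = 0 \<longleftrightarrow> x = (\<lambda>_. 0)"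
proof
  assume "l2_norm J x = 0"
  then have "((\<lambda>i. (cmod (x i))\<^sup>2) has_sum 0) J" using l2_norm_has_sum[OF assms] by simp
  then have "x i = 0" if "i \<in> J" for i
    using nonneg_has_sum_le_0D[of "\<lambda>i. (cmod (x i))\<^sup>2" J 0 i] that by auto
  then show "x = (\<lambda>_. 0)" using l2_eq_0[OF assms] by auto
qed (simp add: l2_norm_def)

lemma l2_norm_finite_support:
  assumes "finite A" "A \<subseteq> J" "\<And>i. i \<notin> A \<Longrightarrow> x i = 0"
  shows "(l2_norm J x)\<^sup>2 = (\<Sum>i\<in>A. (cmod (x i))\<^sup>2)"
proof -
  have "(l2_norm J x)\<^sup>2 = (\<Sum>\<^sub>\<infinity>i\<in>A. (cmod (x i))\<^sup>2)"
    unfolding l2_norm_sq using assms by (intro infsum_cong_neutral) auto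
  then show ?thesis using assms by simp
qed

lemma l2_inner_finite_support:
  assumes "finite A" "A \<subseteq> J" "\<And>i. i \<notin> A \<Longrightarrow> x i = 0"
  shows "l2_inner J x y = (\<Sum>i\<in>A. x i * cnj (y i))"
proof -
  have "l2_inner J x y = (\<Sum>\<^sub>\<infinity>i\<in>A. x i * cnj (y i))"
    unfolding l2_inner_def using assms by (intro infsum_cong_neutral) auto
  then show ?thesis using assms by simp
qed

lemma has_sum_finite_sum:
  fixes f :: "'a \<Rightarrow> 'b \<Rightarrow> complex"
  assumes "\<And>a. a \<in> A \<Longrightarrow> (f a has_sum s a) J"
  shows "((\<lambda>p. \<Sum>a\<in>A. f a p) has_sum (\<Sum>a\<in>A. s a)) J"
  using assms by (induction A rule: infinite_finite_induct) (auto intro: has_sum_add)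

lemma l2_cauchy_schwarz:
  assumes "x \<in> l2 J" "y \<in> l2 J"
  shows "(cmod (l2_inner J x y))\<^sup>2 \<le> (l2_norm J x)\<^sup>2 * (l2_norm J y)\<^sup>2"
proof (cases "l2_norm J y = 0")
  case True
  then have "y = (\<lambda>_. 0)" using l2_norm_eq_0_iff assms by auto
  then show ?thesis by (simp add: l2_inner_def)
next
  case False
  define r where "r = (l2_norm J y)\<^sup>2"
  define z where "z = l2_inner J x y"
  \<comment> \<open>a multiple of the component of \<open>x\<close> orthogonal to \<open>y\<close>\<close>
  define w where "w = (\<lambda>i. of_real r * x i - z * y i)"
  have w: "w \<in> l2 J" unfolding w_def by (intro l2_diff l2_scale assms)
  have "of_real ((l2_norm J w)\<^sup>2) = l2_inner J w w" using l2_inner_self[OF w] by simp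
  also have "\<dots> = of_real r * of_real r * l2_inner J x x - of_real r * cnj z * z
      - z * of_real r * cnj z + z * cnj z * l2_inner J y y"
  proof -
    have *: "(\<lambda>i. of_real r * x i) \<in> l2 J" "(\<lambda>i. z * y i) \<in> l2 J" by (intro l2_scale assms)+
    show ?thesis
      unfolding w_def l2_inner_diff_left[OF * w[unfolded w_def]]
        l2_inner_diff_right[OF * assms(1)] l2_inner_diff_right[OF * assms(2)]
        l2_inner_scale_left l2_inner_scale_right l2_inner_commute[of J y x] z_def[symmetric]
      by (simp add: algebra_simps)
  qed
  also have "\<dots> = of_real (r * (r * (l2_norm J x)\<^sup>2 - (cmod z)\<^sup>2))"
    unfolding l2_inner_self[OF assms(1)] l2_inner_self[OF assms(2)] r_def[symmetric]
    by (simp add: algebra_simps complex_norm_square del: of_real_power)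
  finally have "(l2_norm J w)\<^sup>2 = r * (r * (l2_norm J x)\<^sup>2 - (cmod z)\<^sup>2)"
    by (simp only: of_real_eq_iff)
  moreover have "0 < r" using False by (simp add: r_def)
  ultimately have "0 \<le> r * (l2_norm J x)\<^sup>2 - (cmod z)\<^sup>2"
    by (metis zero_le_mult_iff zero_le_power2 not_le)
  then show ?thesis by (simp add: r_def z_def mult.commute)
qed

text \<open>The Schur product theorem for a Gram kernel: \<open>\<langle>u i, u j\<rangle>\<close> is a sum of rank one kernels
  \<open>u i p * cnj (u j p)\<close>, and multiplying by each of them rescales the coefficients.\<close>

lemma psd_mult_gram:
  assumes K: "psd I K" and u: "\<And>i. i \<in> I \<Longrightarrow> u i \<in> l2 J"
  shows "psd I (\<lambda>i j. K i j * l2_inner J (u i) (u j))"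
proof (rule psdI)
  fix i j assume "i \<in> I" "j \<in> I"
  then show "K j i * l2_inner J (u j) (u i) = cnj (K i j * l2_inner J (u i) (u j))"
    using psd_hermitian[OF K, of i j] l2_inner_commute[of J "u j" "u i"] by simp
next
  fix F and c :: "_ \<Rightarrow> complex" assume F: "finite F" "F \<subseteq> I"
  have "((\<lambda>p. \<Sum>i\<in>F. \<Sum>j\<in>F. (c i * cnj (c j) * K i j) * (u i p * cnj (u j p))) has_sum
      (\<Sum>i\<in>F. \<Sum>j\<in>F. (c i * cnj (c j) * K i j) * l2_inner J (u i) (u j))) J"
    using F u by (intro has_sum_finite_sum has_sum_cmult_right l2_inner_has_sum) auto
  moreover have "(\<Sum>i\<in>F. \<Sum>j\<in>F. (c i * cnj (c j) * K i j) * (u i p * cnj (u j p))) =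
      hform F K (\<lambda>i. c i * u i p) (\<lambda>i. c i * u i p)" for p
    unfolding hform_def by (intro sum.cong refl) (simp add: mult_ac)
  moreover have "(\<Sum>i\<in>F. \<Sum>j\<in>F. (c i * cnj (c j) * K i j) * l2_inner J (u i) (u j)) =
      hform F (\<lambda>i j. K i j * l2_inner J (u i) (u j)) c c"
    unfolding hform_def by (intro sum.cong refl) (simp add: mult_ac)
  ultimately have "((\<lambda>p. hform F K (\<lambda>i. c i * u i p) (\<lambda>i. c i * u i p)) has_sum
      hform F (\<lambda>i j. K i j * l2_inner J (u i) (u j)) c c) J" by simp
  from has_sum_Re[OF this] show "0 \<le> Re (hform F (\<lambda>i j. K i j * l2_inner J (u i) (u j)) c c)"
    by (rule has_sum_nonneg) (rule psd_nonneg[OF K F])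
qed

lemma hform_gram:
  assumes "finite A" "\<And>i. i \<in> A \<Longrightarrow> u i \<in> l2 J"
  shows "hform A (\<lambda>i j. l2_inner J (u i) (u j)) c c = of_real ((l2_norm J (\<lambda>p. \<Sum>i\<in>A. c i * u i p))\<^sup>2)"
proof -
  have "((\<lambda>p. \<Sum>i\<in>A. \<Sum>j\<in>A. (c i * cnj (c j)) * (u i p * cnj (u j p))) has_sum
      (\<Sum>i\<in>A. \<Sum>j\<in>A. (c i * cnj (c j)) * l2_inner J (u i) (u j))) J"
    using assms by (intro has_sum_finite_sum has_sum_cmult_right l2_inner_has_sum) auto
  moreover have "(\<Sum>i\<in>A. \<Sum>j\<in>A. (c i * cnj (c j)) * (u i p * cnj (u j p))) =
      (\<Sum>i\<in>A. c i * u i p) * cnj (\<Sum>i\<in>A. c i * u i p)" for p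
    unfolding cnj_sum sum_product by (intro sum.cong refl) (simp add: mult_ac)
  ultimately have "hform A (\<lambda>i j. l2_inner J (u i) (u j)) c c =
      l2_inner J (\<lambda>p. \<Sum>i\<in>A. c i * u i p) (\<lambda>p. \<Sum>i\<in>A. c i * u i p)"
    unfolding l2_inner_def[of J "\<lambda>p. \<Sum>i\<in>A. c i * u i p"] hform_def by (simp add: infsumI)
  also have "\<dots> = of_real ((l2_norm J (\<lambda>p. \<Sum>i\<in>A. c i * u i p))\<^sup>2)"
    using assms by (intro l2_inner_self l2_sum l2_scale)
  finally show ?thesis .
qed

lemma l2_ballD:
  assumes "x \<in> l2_ball J" shows "x \<in> l2 J" "l2_norm J x < 1" "(l2_norm J x)\<^sup>2 < 1"
  using assms by (auto simp: l2_ball_def abs_square_less_1)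

lemma l2_inner_ball:
  assumes "x \<in> l2_ball J" "y \<in> l2_ball J"
  shows "cmod (l2_inner J x y) < 1" "1 - l2_inner J x y \<noteq> 0"
proof -
  have "(cmod (l2_inner J x y))\<^sup>2 \<le> (l2_norm J x)\<^sup>2 * (l2_norm J y)\<^sup>2"
    using assms by (intro l2_cauchy_schwarz l2_ballD)
  also have "\<dots> < 1"
    using l2_ballD(3)[OF assms(1)] l2_ballD(3)[OF assms(2)]
    by (metis mult_le_one mult_strict_mono' mult_1 zero_le_power2)
  finally show "cmod (l2_inner J x y) < 1"
    by (simp add: abs_square_less_1)
  then show "1 - l2_inner J x y \<noteq> 0" by auto
qed

section \<open>Bounded operators as matrices\<close>

lemma l2_component_le:
  assumes "x \<in> l2 J" shows "(cmod (x i))\<^sup>2 \<le> (l2_norm J x)\<^sup>2"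
proof (cases "i \<in> J")
  case True
  then show ?thesis
    using finite_sum_le_has_sum[OF l2_norm_has_sum[OF assms], of "{i}"] by simp
next
  case False
  then show ?thesis using l2_eq_0[OF assms] by simp
qed

lemma l2_norm_add_sq_le:
  assumes "x \<in> l2 J" "y \<in> l2 J"
  shows "(l2_norm J (\<lambda>i. x i + y i))\<^sup>2 \<le> 2 * (l2_norm J x)\<^sup>2 + 2 * (l2_norm J y)\<^sup>2"
proof (rule has_sum_mono)
  show "((\<lambda>i. (cmod (x i + y i))\<^sup>2) has_sum (l2_norm J (\<lambda>i. x i + y i))\<^sup>2) J"
    by (intro l2_norm_has_sum l2_add assms)
  show "((\<lambda>i. 2 * (cmod (x i))\<^sup>2 + 2 * (cmod (y i))\<^sup>2) has_sum
      2 * (l2_norm J x)\<^sup>2 + 2 * (l2_norm J y)\<^sup>2) J"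
    by (intro has_sum_add has_sum_cmult_right l2_norm_has_sum assms)
qed (rule sq_norm_add_le)

text \<open>A criterion for square summability that applies to families representing bounded
  functionals: the hypothesis bounds the functional on truncations of the conjugate family.\<close>

lemma l2I_bounded:
  assumes "\<And>i. i \<notin> J \<Longrightarrow> x i = 0"
    and bd: "\<And>F. finite F \<Longrightarrow> F \<subseteq> J \<Longrightarrow> (\<Sum>i\<in>F. (cmod (x i))\<^sup>2)\<^sup>2 \<le> K * (\<Sum>i\<in>F. (cmod (x i))\<^sup>2)"
  shows "x \<in> l2 J"
proof -
  have le: "(\<Sum>i\<in>F. (cmod (x i))\<^sup>2) \<le> \<bar>K\<bar>" if "finite F" "F \<subseteq> J" for F
  proof (rule ccontr)
    define t where "t = (\<Sum>i\<in>F. (cmod (x i))\<^sup>2)"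
    assume "\<not> ?thesis"
    then have t: "t > \<bar>K\<bar>" by (simp add: t_def)
    then have "t * t > K * t" by (intro mult_strict_right_mono) auto
    then show False using bd[OF that] by (simp add: t_def power2_eq_square)
  qed
  have s: "(\<lambda>i. (cmod (x i))\<^sup>2) summable_on J"
    by (rule nonneg_bdd_above_summable_on) (auto intro!: bdd_aboveI2[where M = "\<bar>K\<bar>"] le)
  then show ?thesis using assms(1) by (auto simp: l2_def)
qed

lemma l2_split:
  assumes "x \<in> l2 J" "finite F" "F \<subseteq> J"
  shows "(\<lambda>i. if i \<in> F then 0 else x i) \<in> l2 J"
    and "(l2_norm J (\<lambda>i. if i \<in> F then 0 else x i))\<^sup>2 = (l2_norm J x)\<^sup>2 - (\<Sum>i\<in>F. (cmod (x i))\<^sup>2)"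
proof -
  have f: "(\<lambda>i. if i \<in> F then x i else 0) \<in> l2 J"
    using assms(2,3) by (rule l2_finite_support) auto
  have "(\<lambda>i. if i \<in> F then 0 else x i) = (\<lambda>i. x i - (if i \<in> F then x i else 0))" by auto
  then show r: "(\<lambda>i. if i \<in> F then 0 else x i) \<in> l2 J"
    using l2_diff[OF assms(1) f] by simp
  have "((\<lambda>i. (cmod (if i \<in> F then 0 else x i))\<^sup>2 + (cmod (if i \<in> F then x i else 0))\<^sup>2) has_sum
      (l2_norm J (\<lambda>i. if i \<in> F then 0 else x i))\<^sup>2 + (l2_norm J (\<lambda>i. if i \<in> F then x i else 0))\<^sup>2) J"
    by (intro has_sum_add l2_norm_has_sum r f)
  also have "(\<lambda>i. (cmod (if i \<in> F then 0 else x i))\<^sup>2 + (cmod (if i \<in> F then x i else 0))\<^sup>2) =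
      (\<lambda>i. (cmod (x i))\<^sup>2)" by auto
  also have "(l2_norm J (\<lambda>i. if i \<in> F then x i else 0))\<^sup>2 = (\<Sum>i\<in>F. (cmod (x i))\<^sup>2)"
    using l2_norm_finite_support[OF assms(2,3), of "\<lambda>i. if i \<in> F then x i else 0"] by simp
  finally have "(l2_norm J x)\<^sup>2 =
      (l2_norm J (\<lambda>i. if i \<in> F then 0 else x i))\<^sup>2 + (\<Sum>i\<in>F. (cmod (x i))\<^sup>2)"
    using l2_norm_has_sum[OF assms(1)] has_sum_unique by blast
  then show "(l2_norm J (\<lambda>i. if i \<in> F then 0 else x i))\<^sup>2 = (l2_norm J x)\<^sup>2 - (\<Sum>i\<in>F. (cmod (x i))\<^sup>2)"
    by simp
qed

text \<open>A sum converges to \<open>v\<close> if its finite partial sums differ from \<open>v\<close> by no more than a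
  constant times the norm of the tail of a fixed square summable family.\<close>

lemma has_sum_l2_tail_bound:
  assumes x: "x \<in> l2 J"
    and bd: "\<And>F. finite F \<Longrightarrow> F \<subseteq> J \<Longrightarrow>
      (cmod (v - (\<Sum>i\<in>F. f i)))\<^sup>2 \<le> K * (l2_norm J (\<lambda>i. if i \<in> F then 0 else x i))\<^sup>2"
  shows "(f has_sum v) J"
proof -
  have "((\<lambda>F. K * ((l2_norm J x)\<^sup>2 - (\<Sum>i\<in>F. (cmod (x i))\<^sup>2))) \<longlongrightarrow>
      K * ((l2_norm J x)\<^sup>2 - (l2_norm J x)\<^sup>2)) (finite_subsets_at_top J)"
    using l2_norm_has_sum[OF x] unfolding has_sum_def by (intro tendsto_intros)
  then have lim: "((\<lambda>F. K * ((l2_norm J x)\<^sup>2 - (\<Sum>i\<in>F. (cmod (x i))\<^sup>2))) \<longlongrightarrow> 0) (finite_subsets_at_top J)"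
    by simp
  have "((\<lambda>F. (cmod (v - (\<Sum>i\<in>F. f i)))\<^sup>2) \<longlongrightarrow> 0) (finite_subsets_at_top J)"
  proof (rule tendsto_sandwich[OF _ _ tendsto_const lim])
    show "\<forall>\<^sub>F F in finite_subsets_at_top J. (cmod (v - (\<Sum>i\<in>F. f i)))\<^sup>2 \<le>
        K * ((l2_norm J x)\<^sup>2 - (\<Sum>i\<in>F. (cmod (x i))\<^sup>2))"
      using bd l2_split(2)[OF x] by (intro eventually_finite_subsets_at_top_weakI) simp
  qed simp
  then have "((\<lambda>F. sqrt ((cmod (v - (\<Sum>i\<in>F. f i)))\<^sup>2)) \<longlongrightarrow> sqrt 0) (finite_subsets_at_top J)"
    by (rule tendsto_real_sqrt)
  then have "((\<lambda>F. v - (\<Sum>i\<in>F. f i)) \<longlongrightarrow> 0) (finite_subsets_at_top J)"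
    by (simp add: tendsto_norm_zero_iff)
  then have "((\<lambda>F. v - (v - (\<Sum>i\<in>F. f i))) \<longlongrightarrow> v - 0) (finite_subsets_at_top J)"
    by (intro tendsto_intros)
  then show ?thesis by (simp add: has_sum_def)
qed

lemma l2_inner_sum_left:
  assumes "\<And>i. i \<in> A \<Longrightarrow> u i \<in> l2 J" "y \<in> l2 J"
  shows "l2_inner J (\<lambda>p. \<Sum>i\<in>A. c i * u i p) y = (\<Sum>i\<in>A. c i * l2_inner J (u i) y)"
proof -
  have "((\<lambda>p. \<Sum>i\<in>A. c i * (u i p * cnj (y p))) has_sum (\<Sum>i\<in>A. c i * l2_inner J (u i) y)) J"
    using assms by (intro has_sum_finite_sum has_sum_cmult_right l2_inner_has_sum)
  then show ?thesis
    unfolding l2_inner_def[of J "\<lambda>p. \<Sum>i\<in>A. c i * u i p"]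
    by (simp add: infsumI sum_distrib_right mult.assoc)
qed

lemma unit_l2 [simp]: "(\<lambda>i. mat_id J i l) \<in> l2 J"
  by (cases "l \<in> J"; intro l2_finite_support[of "{l} \<inter> J"]) (auto simp: mat_id_def)

lemma l2_inner_unit:
  assumes "b \<in> l2 J"
  shows "l2_inner J (\<lambda>i. mat_id J i l) b = cnj (b l)"
proof (cases "l \<in> J")
  case True
  then show ?thesis
    by (subst l2_inner_finite_support[of "{l}"]) (auto simp: mat_id_def)
next
  case False
  then have "(\<lambda>i. mat_id J i l) = (\<lambda>_. 0)" by (auto simp: mat_id_def)
  then show ?thesis using l2_eq_0[OF assms False] by (simp add: l2_inner_def)
qed

lemma mat_mult_eq_mat_vec: "mat_mult Q A B i l = mat_vec Q A (\<lambda>j. B j l) i"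
  by (simp add: mat_mult_def mat_vec_def)

lemma mat_vec_unit:
  assumes "l \<in> Q"
  shows "mat_vec Q A (\<lambda>j. mat_id Q j l) = (\<lambda>i. A i l)"
proof
  fix i
  have "(\<Sum>\<^sub>\<infinity>j\<in>Q. A i j * mat_id Q j l) = (\<Sum>\<^sub>\<infinity>j\<in>{l}. A i j * mat_id Q j l)"
    using assms by (intro infsum_cong_neutral) (auto simp: mat_id_def)
  then show "mat_vec Q A (\<lambda>j. mat_id Q j l) i = A i l"
    using assms by (simp add: mat_vec_def mat_id_def)
qed

lemma bounded_ops_support: "A \<in> bounded_ops P Q \<Longrightarrow> l \<notin> Q \<Longrightarrow> A i l = 0"
  by (auto simp: bounded_ops_def)

lemma bounded_ops_col:
  assumes "A \<in> bounded_ops P Q"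
  shows "(\<lambda>i. A i l) \<in> l2 P"
proof (cases "l \<in> Q")
  case True
  have "mat_vec Q A (\<lambda>j. mat_id Q j l) \<in> l2 P"
    using assms by (auto simp: bounded_ops_def)
  then show ?thesis by (simp add: mat_vec_unit[OF True])
next
  case False
  then have "(\<lambda>i. A i l) = (\<lambda>_. 0)" using assms by (auto simp: bounded_ops_def)
  then show ?thesis by simp
qed

lemma bounded_ops_bound:
  assumes "A \<in> bounded_ops P Q"
  obtains C where "\<And>x. x \<in> l2 Q \<Longrightarrow> mat_vec Q A x \<in> l2 P"
    "\<And>x. x \<in> l2 Q \<Longrightarrow> (l2_norm P (mat_vec Q A x))\<^sup>2 \<le> C * (l2_norm Q x)\<^sup>2" "C \<ge> 0"
proof -
  from assms obtain C where C: "\<And>x. x \<in> l2 Q \<Longrightarrow> mat_vec Q A x \<in> l2 P \<and>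
      l2_norm P (mat_vec Q A x) \<le> C * l2_norm Q x" by (auto simp: bounded_ops_def)
  then have "(l2_norm P (mat_vec Q A x))\<^sup>2 \<le> C\<^sup>2 * (l2_norm Q x)\<^sup>2" if "x \<in> l2 Q" for x
    using power_mono[of _ _ 2] that by (fastforce simp flip: power_mult_distrib)
  then show thesis using C that[of "C\<^sup>2"] by auto
qed

lemma bounded_ops_row:
  assumes "A \<in> bounded_ops P Q"
  shows "(\<lambda>j. A i j) \<in> l2 Q"
proof -
  from bounded_ops_bound[OF assms] obtain C where C: "\<And>x. x \<in> l2 Q \<Longrightarrow> mat_vec Q A x \<in> l2 P"
    "\<And>x. x \<in> l2 Q \<Longrightarrow> (l2_norm P (mat_vec Q A x))\<^sup>2 \<le> C * (l2_norm Q x)\<^sup>2" by metis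
  show ?thesis
  proof (rule l2I_bounded)
    fix F assume F: "finite F" "F \<subseteq> Q"
    define y where "y j = (if j \<in> F then cnj (A i j) else 0)" for j
    have y: "y \<in> l2 Q" using F by (rule l2_finite_support) (auto simp: y_def)
    have "mat_vec Q A y i = (\<Sum>\<^sub>\<infinity>j\<in>F. A i j * y j)"
      unfolding mat_vec_def using F by (intro infsum_cong_neutral) (auto simp: y_def)
    also have "\<dots> = (\<Sum>j\<in>F. A i j * cnj (A i j))" using F by (simp add: y_def)
    also have "\<dots> = of_real (\<Sum>j\<in>F. (cmod (A i j))\<^sup>2)"
      by (simp add: complex_norm_square del: of_real_power)
    finally have "(\<Sum>j\<in>F. (cmod (A i j))\<^sup>2)\<^sup>2 = (cmod (mat_vec Q A y i))\<^sup>2"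
      by (simp only: norm_of_real power2_abs)
    also have "\<dots> \<le> (l2_norm P (mat_vec Q A y))\<^sup>2" by (rule l2_component_le[OF C(1)[OF y]])
    also have "\<dots> \<le> C * (l2_norm Q y)\<^sup>2" by (rule C(2)[OF y])
    also have "(l2_norm Q y)\<^sup>2 = (\<Sum>j\<in>F. (cmod (y j))\<^sup>2)"
      using F by (rule l2_norm_finite_support) (auto simp: y_def)
    also have "\<dots> = (\<Sum>j\<in>F. (cmod (A i j))\<^sup>2)" by (simp add: y_def)
    finally show "(\<Sum>j\<in>F. (cmod (A i j))\<^sup>2)\<^sup>2 \<le> C * (\<Sum>j\<in>F. (cmod (A i j))\<^sup>2)" .
  qed (use assms in \<open>auto simp: bounded_ops_def\<close>)
qed

lemma mat_vec_eq_inner: "mat_vec Q A x i = l2_inner Q x (\<lambda>j. cnj (A i j))"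
  by (simp add: mat_vec_def l2_inner_def mult.commute)

lemma mat_vec_diff:
  assumes "A \<in> bounded_ops P Q" "x \<in> l2 Q" "y \<in> l2 Q"
  shows "mat_vec Q A (\<lambda>j. x j - y j) = (\<lambda>i. mat_vec Q A x i - mat_vec Q A y i)"
  using assms bounded_ops_row[OF assms(1)]
  by (auto simp: mat_vec_eq_inner l2_inner_diff_left)

lemma mat_vec_scale: "mat_vec Q A (\<lambda>j. a * x j) = (\<lambda>i. a * mat_vec Q A x i)"
  by (auto simp: mat_vec_eq_inner l2_inner_scale_left)

text \<open>The matrix product represents the composition of bounded operators.  Interchanging the
  two infinite sums is justified by bounding the image of the tails of \<open>x\<close> under both operators.\<close>

lemma mat_vec_mat_mult:
  assumes A: "A \<in> bounded_ops P Q" and B: "B \<in> bounded_ops Q R" and x: "x \<in> l2 R"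
  shows "mat_vec R (mat_mult Q A B) x = mat_vec Q A (mat_vec R B x)"
proof
  fix i
  obtain C where C: "\<And>x. x \<in> l2 Q \<Longrightarrow> mat_vec Q A x \<in> l2 P"
    "\<And>x. x \<in> l2 Q \<Longrightarrow> (l2_norm P (mat_vec Q A x))\<^sup>2 \<le> C * (l2_norm Q x)\<^sup>2" "C \<ge> 0"
    using bounded_ops_bound[OF A] by metis
  obtain C' where C': "\<And>x. x \<in> l2 R \<Longrightarrow> mat_vec R B x \<in> l2 Q"
    "\<And>x. x \<in> l2 R \<Longrightarrow> (l2_norm Q (mat_vec R B x))\<^sup>2 \<le> C' * (l2_norm R x)\<^sup>2" "C' \<ge> 0"
    using bounded_ops_bound[OF B] by metis
  have row: "(\<lambda>j. cnj (A i j)) \<in> l2 Q" using bounded_ops_row[OF A] by simp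
  have "((\<lambda>l. mat_mult Q A B i l * x l) has_sum mat_vec Q A (mat_vec R B x) i) R"
  proof (rule has_sum_l2_tail_bound[OF x])
    fix F assume F: "finite F" "F \<subseteq> R"
    define xF where "xF l = (if l \<in> F then x l else 0)" for l
    define y where "y l = (if l \<in> F then 0 else x l)" for l
    have xF: "xF \<in> l2 R" using F by (rule l2_finite_support) (auto simp: xF_def)
    have y: "y \<in> l2 R" unfolding y_def by (rule l2_split(1)[OF x F])
    have xF_eq: "(\<lambda>l. x l - y l) = xF" by (auto simp: xF_def y_def)
    have BxF: "mat_vec R B xF = (\<lambda>j. \<Sum>l\<in>F. x l * B j l)"
    proof
      fix j
      have "mat_vec R B xF j = (\<Sum>\<^sub>\<infinity>l\<in>F. B j l * xF l)"
        unfolding mat_vec_def using F by (intro infsum_cong_neutral) (auto simp: xF_def)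
      then show "mat_vec R B xF j = (\<Sum>l\<in>F. x l * B j l)"
        using F by (simp add: xF_def mult.commute)
    qed
    have "(\<Sum>l\<in>F. mat_mult Q A B i l * x l) = mat_vec Q A (mat_vec R B xF) i"
      unfolding BxF mat_mult_eq_mat_vec mat_vec_eq_inner
        l2_inner_sum_left[OF bounded_ops_col[OF B] row] by (simp only: mult.commute)
    also have "\<dots> = mat_vec Q A (mat_vec R B x) i - mat_vec Q A (mat_vec R B y) i"
      unfolding xF_eq[symmetric] mat_vec_diff[OF B x y]
      by (simp add: mat_vec_diff[OF A C'(1)[OF x] C'(1)[OF y]])
    finally have "(cmod (mat_vec Q A (mat_vec R B x) i - (\<Sum>l\<in>F. mat_mult Q A B i l * x l)))\<^sup>2 =
        (cmod (mat_vec Q A (mat_vec R B y) i))\<^sup>2" by simp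
    also have "\<dots> \<le> (l2_norm P (mat_vec Q A (mat_vec R B y)))\<^sup>2"
      by (intro l2_component_le C C' y)
    also have "\<dots> \<le> C * (l2_norm Q (mat_vec R B y))\<^sup>2" by (intro C C' y)
    also have "\<dots> \<le> C * (C' * (l2_norm R y)\<^sup>2)" by (intro mult_left_mono C C' y)
    finally show "(cmod (mat_vec Q A (mat_vec R B x) i - (\<Sum>l\<in>F. mat_mult Q A B i l * x l)))\<^sup>2 \<le>
        (C * C') * (l2_norm R (\<lambda>l. if l \<in> F then 0 else x l))\<^sup>2" by (simp add: y_def[abs_def])
  qed
  then show "mat_vec R (mat_mult Q A B) x i = mat_vec Q A (mat_vec R B x) i"
    unfolding mat_vec_def[of R "mat_mult Q A B"] by (rule infsumI)
qed

section \<open>Rank one perturbations of the identity and the Blaschke factor\<close>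

text \<open>The matrix \<open>I + s a\<^sup>* a\<close> of a real rank one perturbation of the identity, for a row vector
  \<open>a\<close>.  Both the square root of \<open>I - a\<^sup>* a\<close> and its inverse are of this form.\<close>

definition rank_one_pert :: "'i set \<Rightarrow> ('i \<Rightarrow> complex) \<Rightarrow> real \<Rightarrow> ('i, 'i) mat" where
  "rank_one_pert J a s = (\<lambda>i j. mat_id J i j + of_real s * cnj (a i) * a j)"

lemma mat_vec_rank_one_pert:
  assumes a: "a \<in> l2 J" and x: "x \<in> l2 J"
  shows "mat_vec J (rank_one_pert J a s) x =
    (\<lambda>i. x i + of_real s * l2_inner J x (\<lambda>j. cnj (a j)) * cnj (a i))"
proof
  fix i
  have "((\<lambda>j. mat_id J i j * x j) has_sum x i) J"
    using l2_eq_0[OF x, of i] by (cases "i \<in> J")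
      (auto simp: mat_id_def intro!: has_sum_finite_neutralI[of "{i} \<inter> J"] split: if_splits)
  moreover have "((\<lambda>j. (of_real s * cnj (a i)) * (x j * cnj (cnj (a j)))) has_sum
      (of_real s * cnj (a i)) * l2_inner J x (\<lambda>j. cnj (a j))) J"
    using a x by (intro has_sum_cmult_right l2_inner_has_sum) auto
  ultimately have "((\<lambda>j. mat_id J i j * x j + (of_real s * cnj (a i)) * (x j * cnj (cnj (a j))))
      has_sum x i + (of_real s * cnj (a i)) * l2_inner J x (\<lambda>j. cnj (a j))) J"
    by (rule has_sum_add)
  then show "mat_vec J (rank_one_pert J a s) x i =
      x i + of_real s * l2_inner J x (\<lambda>j. cnj (a j)) * cnj (a i)"
    unfolding mat_vec_def rank_one_pert_def by (simp add: infsumI algebra_simps)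
qed

lemma rank_one_pert_support: "a \<in> l2 J \<Longrightarrow> rank_one_pert J a s i j \<noteq> 0 \<Longrightarrow> i \<in> J \<and> j \<in> J"
  using l2_eq_0[of a J] by (auto simp: rank_one_pert_def mat_id_def split: if_splits)

lemma rank_one_pert_col: "a \<in> l2 J \<Longrightarrow> (\<lambda>i. rank_one_pert J a s i l) \<in> l2 J"
  unfolding rank_one_pert_def
  using l2_add[OF unit_l2 l2_scale[of "\<lambda>i. cnj (a i)" J "of_real s * a l"]] by (simp add: mult_ac)

lemma l2_inner_cnj_self:
  "a \<in> l2 J \<Longrightarrow> l2_inner J (\<lambda>i. cnj (a i)) (\<lambda>i. cnj (a i)) = of_real ((l2_norm J a)\<^sup>2)"
  using l2_inner_self[of "\<lambda>i. cnj (a i)" J] by simp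

lemma mat_mult_rank_one_pert:
  assumes a: "a \<in> l2 J"
  shows "mat_mult J (rank_one_pert J a s) (rank_one_pert J a t) =
    rank_one_pert J a (s + t + s * t * (l2_norm J a)\<^sup>2)"
proof (intro ext)
  fix i l
  have ca: "(\<lambda>i. cnj (a i)) \<in> l2 J" using a by simp
  have "l2_inner J (\<lambda>j. rank_one_pert J a t j l) (\<lambda>j. cnj (a j)) =
      l2_inner J (\<lambda>j. mat_id J j l + (of_real t * a l) * cnj (a j)) (\<lambda>j. cnj (a j))"
    by (simp add: rank_one_pert_def mult_ac)
  also have "\<dots> = a l + of_real t * a l * of_real ((l2_norm J a)\<^sup>2)"
    by (subst l2_inner_add_left[OF unit_l2 l2_scale[OF ca] ca])
      (simp add: l2_inner_unit[OF ca] l2_inner_scale_left l2_inner_cnj_self[OF a] del: of_real_power)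
  finally show "mat_mult J (rank_one_pert J a s) (rank_one_pert J a t) i l =
      rank_one_pert J a (s + t + s * t * (l2_norm J a)\<^sup>2) i l"
    unfolding mat_mult_eq_mat_vec mat_vec_rank_one_pert[OF a rank_one_pert_col[OF a]]
    by (simp add: rank_one_pert_def algebra_simps)
qed

lemma rank_one_pert_bounded:
  assumes a: "a \<in> l2 J"
  shows "rank_one_pert J a s \<in> bounded_ops J J"
proof -
  define r where "r = (l2_norm J a)\<^sup>2"
  have ca: "(\<lambda>i. cnj (a i)) \<in> l2 J" using a by simp
  have "mat_vec J (rank_one_pert J a s) x \<in> l2 J \<and>
     l2_norm J (mat_vec J (rank_one_pert J a s) x) \<le> sqrt (2 + 2 * s\<^sup>2 * r * r) * l2_norm J x"
    if x: "x \<in> l2 J" for x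
  proof
    define z where "z = of_real s * l2_inner J x (\<lambda>j. cnj (a j))"
    have eq: "mat_vec J (rank_one_pert J a s) x = (\<lambda>i. x i + z * cnj (a i))"
      unfolding z_def by (rule mat_vec_rank_one_pert[OF a x])
    show "mat_vec J (rank_one_pert J a s) x \<in> l2 J"
      unfolding eq by (intro l2_add l2_scale x ca)
    have "(l2_norm J (\<lambda>i. x i + z * cnj (a i)))\<^sup>2 \<le>
        2 * (l2_norm J x)\<^sup>2 + 2 * (l2_norm J (\<lambda>i. z * cnj (a i)))\<^sup>2"
      by (intro l2_norm_add_sq_le l2_scale x ca)
    also have "(l2_norm J (\<lambda>i. z * cnj (a i)))\<^sup>2 = (cmod z)\<^sup>2 * r"
      unfolding l2_norm_scale by (simp add: power_mult_distrib r_def)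
    also have "(cmod z)\<^sup>2 \<le> s\<^sup>2 * ((l2_norm J x)\<^sup>2 * r)"
      using l2_cauchy_schwarz[OF x ca]
      by (simp add: z_def norm_mult power_mult_distrib r_def mult_left_mono)
    finally have "(l2_norm J (\<lambda>i. x i + z * cnj (a i)))\<^sup>2 \<le> (2 + 2 * s\<^sup>2 * r * r) * (l2_norm J x)\<^sup>2"
      by (simp add: algebra_simps mult_right_mono r_def)
    then have "sqrt ((l2_norm J (\<lambda>i. x i + z * cnj (a i)))\<^sup>2) \<le> sqrt ((2 + 2 * s\<^sup>2 * r * r) * (l2_norm J x)\<^sup>2)"
      by (rule real_sqrt_le_mono)
    then show "l2_norm J (mat_vec J (rank_one_pert J a s) x) \<le> sqrt (2 + 2 * s\<^sup>2 * r * r) * l2_norm J x"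
      unfolding eq by (simp add: real_sqrt_mult)
  qed
  then show ?thesis
    unfolding bounded_ops_def using rank_one_pert_support[OF a] by blast
qed

text \<open>For \<open>s \<le> 0\<close> the quadratic form of \<open>I + s a\<^sup>* a\<close> is bounded below by the factor
  \<open>1 + s \<parallel>a\<parallel>\<^sup>2\<close>.\<close>

lemma rank_one_pert_form:
  assumes a: "a \<in> l2 J" and x: "x \<in> l2 J" and "s \<le> 0"
  shows "l2_inner J (mat_vec J (rank_one_pert J a s) x) x \<in> \<real>"
    and "(1 + s * (l2_norm J a)\<^sup>2) * (l2_norm J x)\<^sup>2 \<le>
      Re (l2_inner J (mat_vec J (rank_one_pert J a s) x) x)"
proof -
  have ca: "(\<lambda>i. cnj (a i)) \<in> l2 J" using a by simp
  define z where "z = l2_inner J x (\<lambda>j. cnj (a j))"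
  have "l2_inner J (mat_vec J (rank_one_pert J a s) x) x =
      l2_inner J x x + of_real s * z * l2_inner J (\<lambda>i. cnj (a i)) x"
    unfolding mat_vec_rank_one_pert[OF a x] z_def[symmetric]
    by (subst l2_inner_add_left[OF x l2_scale[OF ca] x]) (simp add: l2_inner_scale_left)
  also have "l2_inner J (\<lambda>i. cnj (a i)) x = cnj z" unfolding z_def by (rule l2_inner_commute)
  also have "l2_inner J x x + of_real s * z * cnj z = of_real ((l2_norm J x)\<^sup>2 + s * (cmod z)\<^sup>2)"
    unfolding l2_inner_self[OF x] by (simp add: complex_norm_square mult.assoc del: of_real_power)
  finally have eq: "l2_inner J (mat_vec J (rank_one_pert J a s) x) x = of_real ((l2_norm J x)\<^sup>2 + s * (cmod z)\<^sup>2)" .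
  then show "l2_inner J (mat_vec J (rank_one_pert J a s) x) x \<in> \<real>" by simp
  have "(cmod z)\<^sup>2 \<le> (l2_norm J x)\<^sup>2 * (l2_norm J a)\<^sup>2"
    using l2_cauchy_schwarz[OF x ca] by (simp add: z_def)
  then have "s * ((l2_norm J x)\<^sup>2 * (l2_norm J a)\<^sup>2) \<le> s * (cmod z)\<^sup>2"
    using \<open>s \<le> 0\<close> by (rule mult_left_mono_neg)
  then show "(1 + s * (l2_norm J a)\<^sup>2) * (l2_norm J x)\<^sup>2 \<le>
      Re (l2_inner J (mat_vec J (rank_one_pert J a s) x) x)"
    unfolding eq by (simp add: algebra_simps del: of_real_power of_real_add of_real_mult)
qed

text \<open>The positive square root \<open>S\<close> of \<open>I - a\<^sup>* a\<close>.  Uniqueness: another positive root \<open>T\<close>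
  commutes with \<open>T\<^sup>2 = I - a\<^sup>* a\<close>, hence with \<open>S\<close>, an affine function of it.  Then
  \<open>(S + T) (S - T) x = (S\<^sup>2 - T\<^sup>2) x = 0\<close>, and since \<open>S\<close> is bounded below by \<open>\<sigma> > 0\<close> and \<open>T\<close> is
  positive, \<open>(S - T) x = 0\<close>.\<close>

lemma op_sqrt_rank_one_pert:
  assumes "a \<in> l2_ball J"
  defines "\<sigma> \<equiv> sqrt (1 - (l2_norm J a)\<^sup>2)"
  shows "op_sqrt J (rank_one_pert J a (- 1)) = rank_one_pert J a (- 1 / (1 + \<sigma>))"
proof -
  define r where "r = (l2_norm J a)\<^sup>2"
  have a: "a \<in> l2 J" and r: "0 \<le> r" "r < 1" using l2_ballD[OF assms(1)] by (auto simp: r_def)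
  have \<sigma>: "0 < \<sigma>" "r = 1 - \<sigma>\<^sup>2" using r by (auto simp: \<sigma>_def r_def)
  have ca: "(\<lambda>i. cnj (a i)) \<in> l2 J" using a by simp
  define c where "c = - 1 / (1 + \<sigma>)"
  have c: "c \<le> 0" "1 + c * r = \<sigma>"
    using \<sigma> by (auto simp: c_def field_simps power2_eq_square)
  have "c + c + c * c * r = c * (1 + \<sigma>)"
    unfolding c(2)[symmetric] by (simp add: algebra_simps)
  also have "\<dots> = - 1" using \<sigma> by (simp add: c_def)
  finally have c3: "c + c + c * c * r = - 1" .
  define S where "S = mat_vec J (rank_one_pert J a c)"
  define b where "b = (\<lambda>i. cnj (a i))"
  have b: "b \<in> l2 J" using ca by (simp add: b_def)
  have S: "S x = (\<lambda>i. x i + of_real c * l2_inner J x b * b i)" if "x \<in> l2 J" for x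
    unfolding S_def b_def by (rule mat_vec_rank_one_pert[OF a that])
  have Sl2: "S x \<in> l2 J" if "x \<in> l2 J" for x
    unfolding S[OF that] by (intro l2_add l2_scale that b)
  have sqr: "mat_mult J (rank_one_pert J a c) (rank_one_pert J a c) = rank_one_pert J a (- 1)"
    unfolding mat_mult_rank_one_pert[OF a] r_def[symmetric] c3 ..
  note bdd = rank_one_pert_bounded[OF a]
  show ?thesis
    unfolding op_sqrt_def c_def[symmetric]
  proof (rule the_equality)
    show "positive_op J (rank_one_pert J a c) \<and>
        mat_mult J (rank_one_pert J a c) (rank_one_pert J a c) = rank_one_pert J a (- 1)"
      unfolding positive_op_def
    proof (intro conjI ballI bdd sqr)
      fix x assume x: "x \<in> l2 J"
      have "0 \<le> (1 + c * r) * (l2_norm J x)\<^sup>2" unfolding c(2) using \<sigma> by simp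
      then show "l2_inner J (mat_vec J (rank_one_pert J a c) x) x \<in> \<real>\<^sub>\<ge>\<^sub>0"
        using rank_one_pert_form[OF a x c(1)]
        by (simp add: complex_nonneg_Reals_iff r_def complex_is_Real_iff)
    qed
  next
    fix C assume C: "positive_op J C \<and> mat_mult J C C = rank_one_pert J a (- 1)"
    then have Cb: "C \<in> bounded_ops J J" by (simp add: positive_op_def)
    define T where "T = mat_vec J C"
    have Tl2: "T x \<in> l2 J" if "x \<in> l2 J" for x
      using Cb that by (auto simp: T_def bounded_ops_def)
    have Tdiff: "T (\<lambda>i. x i - y i) = (\<lambda>i. T x i - T y i)" if "x \<in> l2 J" "y \<in> l2 J" for x y
      unfolding T_def using Cb that by (rule mat_vec_diff)
    have Tscale: "T (\<lambda>i. \<mu> * x i) = (\<lambda>i. \<mu> * T x i)" for \<mu> x unfolding T_def by (rule mat_vec_scale)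
    have TT: "T (T x) = (\<lambda>i. x i - l2_inner J x b * b i)" if "x \<in> l2 J" for x
    proof -
      have "T (T x) = mat_vec J (mat_mult J C C) x"
        unfolding T_def by (rule mat_vec_mat_mult[OF Cb Cb that, symmetric])
      then show ?thesis using C mat_vec_rank_one_pert[OF a that, of "-1"] by (simp add: b_def)
    qed
    have SS: "S (S x) = T (T x)" if "x \<in> l2 J" for x
    proof -
      have "S (S x) = mat_vec J (mat_mult J (rank_one_pert J a c) (rank_one_pert J a c)) x"
        unfolding S_def by (rule mat_vec_mat_mult[OF bdd bdd that, symmetric])
      then show ?thesis
        unfolding sqr using TT[OF that] mat_vec_rank_one_pert[OF a that, of "-1"] by (simp add: b_def)
    qed
    have comm0: "l2_inner J x b * T b i = l2_inner J (T x) b * b i" if x: "x \<in> l2 J" for x i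
    proof -
      have "T (T (T x)) = (\<lambda>i. T x i - l2_inner J x b * T b i)"
        unfolding TT[OF x] using x b by (simp add: Tdiff Tscale l2_scale)
      then have "(\<lambda>i. T x i - l2_inner J x b * T b i) = (\<lambda>i. T x i - l2_inner J (T x) b * b i)"
        using TT[OF Tl2[OF x]] by simp
      then show ?thesis by (metis (mono_tags, lifting) diff_left_imp_eq)
    qed
    have comm: "T (S x) = S (T x)" if x: "x \<in> l2 J" for x
    proof -
      have "T (S x) = T (\<lambda>i. x i - (- of_real c * l2_inner J x b) * b i)"
        unfolding S[OF x] by (simp add: algebra_simps)
      also have "\<dots> = (\<lambda>i. T x i - (- of_real c * l2_inner J x b) * T b i)"
        unfolding Tdiff[OF x l2_scale[OF b]] Tscale ..
      also have "\<dots> = (\<lambda>i. T x i + of_real c * (l2_inner J x b * T b i))" by (simp add: mult.assoc)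
      finally show ?thesis unfolding comm0[OF x] S[OF Tl2[OF x]] by (simp add: mult.assoc)
    qed
    have ST: "S x = T x" if x: "x \<in> l2 J" for x
    proof -
      define y where "y = (\<lambda>i. S x i - T x i)"
      have y: "y \<in> l2 J" unfolding y_def by (intro l2_diff Sl2 Tl2 x)
      have "S y = (\<lambda>i. S (S x) i - S (T x) i)"
        unfolding y_def S_def using bdd Sl2[OF x, unfolded S_def] Tl2[OF x] by (rule mat_vec_diff)
      moreover have "T y = (\<lambda>i. T (S x) i - T (T x) i)"
        unfolding y_def by (intro Tdiff Sl2 Tl2 x)
      ultimately have "(\<lambda>i. S y i + T y i) = (\<lambda>_. 0)"
        using SS[OF x] comm[OF x] by auto
      then have "l2_inner J (S y) y + l2_inner J (T y) y = 0"
        using l2_inner_add_left[OF Sl2[OF y] Tl2[OF y] y] by (simp add: l2_inner_def)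
      moreover have "0 \<le> Re (l2_inner J (T y) y)"
        using C y by (auto simp: positive_op_def T_def complex_nonneg_Reals_iff)
      ultimately have "Re (l2_inner J (S y) y) \<le> 0"
        by (metis add_le_same_cancel1 plus_complex.sel(1) add.commute le_add_same_cancel2 zero_complex.sel(1) order_trans)
      then have "\<sigma> * (l2_norm J y)\<^sup>2 \<le> 0"
        using rank_one_pert_form(2)[OF a y c(1)] unfolding r_def[symmetric] c(2) S_def by linarith
      then have "l2_norm J y = 0" using \<sigma>(1) by (simp add: mult_le_0_iff)
      then have "y = (\<lambda>_. 0)" using l2_norm_eq_0_iff[OF y] by simp
      then show "S x = T x" unfolding y_def by (metis (no_types) eq_iff_diff_eq_0 ext)
    qed
    show "C = rank_one_pert J a c"
    proof (intro ext)
      fix i l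
      show "C i l = rank_one_pert J a c i l"
      proof (cases "l \<in> J")
        case True
        then show ?thesis
          using ST[OF unit_l2, of l] by (simp add: S_def T_def mat_vec_unit fun_eq_iff)
      next
        case False
        then show ?thesis using Cb bdd[of c] by (metis bounded_ops_support)
      qed
    qed
  qed
qed

lemma op_inverse_rank_one_pert:
  assumes a: "a \<in> l2 J" and d: "s + t + s * t * (l2_norm J a)\<^sup>2 = 0"
  shows "op_inverse J (rank_one_pert J a s) = rank_one_pert J a t"
proof -
  have zero: "rank_one_pert J a 0 = mat_id J" by (simp add: rank_one_pert_def)
  have st: "mat_mult J (rank_one_pert J a s) (rank_one_pert J a t) = mat_id J"
    unfolding mat_mult_rank_one_pert[OF a] d by (rule zero)
  have ts: "mat_mult J (rank_one_pert J a t) (rank_one_pert J a s) = mat_id J"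
    using d unfolding mat_mult_rank_one_pert[OF a]
    by (metis add.commute mult.commute zero)
  note bdd = rank_one_pert_bounded[OF a]
  show ?thesis
    unfolding op_inverse_def
  proof (rule the_equality)
    fix B assume B: "B \<in> bounded_ops J J \<and> mat_mult J (rank_one_pert J a s) B = mat_id J \<and>
      mat_mult J B (rank_one_pert J a s) = mat_id J"
    show "B = rank_one_pert J a t"
    proof (intro ext)
      fix i l
      have col: "(\<lambda>i. B i l) \<in> l2 J" using B by (blast intro: bounded_ops_col)
      have "(\<lambda>i. B i l) = mat_vec J (mat_id J) (\<lambda>i. B i l)"
        unfolding zero[symmetric] mat_vec_rank_one_pert[OF a col] by simp
      also have "\<dots> = mat_vec J (rank_one_pert J a t) (mat_vec J (rank_one_pert J a s) (\<lambda>i. B i l))"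
        unfolding ts[symmetric] by (rule mat_vec_mat_mult[OF bdd bdd col])
      also have "mat_vec J (rank_one_pert J a s) (\<lambda>i. B i l) = (\<lambda>i. mat_id J i l)"
        using B by (metis mat_mult_eq_mat_vec ext)
      finally have *: "(\<lambda>i. B i l) = mat_vec J (rank_one_pert J a t) (\<lambda>i. mat_id J i l)" .
      show "B i l = rank_one_pert J a t i l"
      proof (cases "l \<in> J")
        case True
        then show ?thesis using * by (simp add: mat_vec_unit fun_eq_iff)
      next
        case False
        then show ?thesis using B bdd[of t] by (metis bounded_ops_support)
      qed
    qed
  qed (use st ts bdd in auto)
qed

lemma vec_mat_rank_one_pert:
  assumes a: "a \<in> l2 J" and x: "x \<in> l2 J"
  shows "vec_mat J x (rank_one_pert J a s) = (\<lambda>j. x j + of_real s * l2_inner J x a * a j)"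
proof
  fix j
  have "((\<lambda>i. x i * mat_id J i j) has_sum x j) J"
    using l2_eq_0[OF x, of j] by (cases "j \<in> J")
      (auto simp: mat_id_def intro!: has_sum_finite_neutralI[of "{j} \<inter> J"] split: if_splits)
  moreover have "((\<lambda>i. (of_real s * a j) * (x i * cnj (a i))) has_sum
      (of_real s * a j) * l2_inner J x a) J"
    by (intro has_sum_cmult_right l2_inner_has_sum a x)
  ultimately have "((\<lambda>i. x i * mat_id J i j + (of_real s * a j) * (x i * cnj (a i)))
      has_sum x j + (of_real s * a j) * l2_inner J x a) J"
    by (rule has_sum_add)
  then show "vec_mat J x (rank_one_pert J a s) j = x j + of_real s * l2_inner J x a * a j"
    unfolding vec_mat_def rank_one_pert_def by (simp add: infsumI algebra_simps)
qed

text \<open>An explicit form of the Blaschke factor, in which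
  \<open>(I - a\<^sup>* a)\<^sup>-\<^sup>1\<^sup>/\<^sup>2 = I + a\<^sup>* a / (\<sigma> (1 + \<sigma>))\<close>; it is valid also for \<open>a = 0\<close>.\<close>

lemma blaschke_eq:
  assumes "a \<in> l2_ball J" "x \<in> l2 J"
  defines "\<sigma> \<equiv> sqrt (1 - (l2_norm J a)\<^sup>2)"
  shows "blaschke J a x = (\<lambda>j. (of_real \<sigma> / (1 - l2_inner J x a)) *
    ((x j - a j) + (of_real (1 / (\<sigma> * (1 + \<sigma>))) * (l2_inner J x a - l2_inner J a a)) * a j))"
proof -
  have a: "a \<in> l2 J" by (rule l2_ballD[OF assms(1)])
  have \<sigma>: "0 < \<sigma>" "(l2_norm J a)\<^sup>2 = 1 - \<sigma>\<^sup>2" using l2_ballD(3)[OF assms(1)] by (auto simp: \<sigma>_def)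
  have w: "(\<lambda>i. x i - a i) \<in> l2 J" by (intro l2_diff a assms)
  have A: "(\<lambda>i l. mat_id J i l - cnj (a i) * a l) = rank_one_pert J a (- 1)"
    by (simp add: rank_one_pert_def)
  have inv: "op_inverse J (op_sqrt J (\<lambda>i l. mat_id J i l - cnj (a i) * a l)) =
      rank_one_pert J a (1 / (\<sigma> * (1 + \<sigma>)))"
    unfolding A op_sqrt_rank_one_pert[OF assms(1)] \<sigma>_def[symmetric]
  proof (rule op_inverse_rank_one_pert[OF a])
    have "1 + \<sigma> \<noteq> 0" using \<sigma> by simp
    then show "- 1 / (1 + \<sigma>) + 1 / (\<sigma> * (1 + \<sigma>)) + - 1 / (1 + \<sigma>) * (1 / (\<sigma> * (1 + \<sigma>))) * (l2_norm J a)\<^sup>2 = 0"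
      unfolding \<sigma>(2) using \<sigma>(1) by (simp add: divide_simps) (simp add: power2_eq_square algebra_simps)
  qed
  have "1 - l2_inner J a a = of_real (1 - (l2_norm J a)\<^sup>2)" by (simp add: l2_inner_self[OF a])
  then have "csqrt (1 - l2_inner J a a) = of_real \<sigma>"
    using l2_ballD(3)[OF assms(1)] by (simp add: \<sigma>_def csqrt_of_real_nonneg del: of_real_diff)
  then show ?thesis
    unfolding blaschke_def inv vec_mat_rank_one_pert[OF a w] l2_inner_diff_left[OF assms(2) a a]
    by simp
qed

lemma blaschke_l2:
  assumes "a \<in> l2_ball J" "x \<in> l2 J"
  shows "blaschke J a x \<in> l2 J"
  unfolding blaschke_eq[OF assms] using l2_ballD(1)[OF assms(1)] assms(2)
  by (intro l2_scale l2_add l2_diff)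

lemma blaschke_center:
  assumes "a \<in> l2_ball J"
  shows "blaschke J a a = (\<lambda>_. 0)"
  unfolding blaschke_eq[OF assms l2_ballD(1)[OF assms]] by simp

lemma blaschke_inner:
  assumes a: "a \<in> l2_ball J" and x: "x \<in> l2_ball J" and y: "y \<in> l2_ball J"
  shows "l2_inner J (blaschke J a x) (blaschke J a y) =
    1 - (1 - l2_inner J a a) * (1 - l2_inner J x y) / ((1 - l2_inner J x a) * (1 - l2_inner J a y))"
proof -
  define \<sigma> where "\<sigma> = sqrt (1 - (l2_norm J a)\<^sup>2)"
  have \<sigma>: "0 < \<sigma>" "(l2_norm J a)\<^sup>2 = 1 - \<sigma>\<^sup>2" using l2_ballD(3)[OF a] by (auto simp: \<sigma>_def)
  define s where "s = complex_of_real \<sigma>"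
  have s: "s \<noteq> 0" "1 + s \<noteq> 0" "cnj s = s" using \<sigma>(1)
    by (auto simp: s_def complex_eq_iff)
  note l2 = l2_ballD(1)[OF a] l2_ballD(1)[OF x] l2_ballD(1)[OF y]
  have aa: "l2_inner J a a = 1 - s\<^sup>2" unfolding l2_inner_self[OF l2(1)] \<sigma>(2) by (simp add: s_def)
  define X where "X = l2_inner J x a"
  define Y where "Y = l2_inner J a y"
  define Z where "Z = l2_inner J x y"
  define d where "d = 1 / (s * (1 + s))"
  have cd: "cnj d = d" using s(3) by (simp add: d_def)
  have Yc: "l2_inner J y a = cnj Y" "l2_inner J a x = cnj X"
    by (simp_all add: X_def Y_def flip: l2_inner_commute)
  have X1: "1 - X \<noteq> 0" unfolding X_def by (rule l2_inner_ball[OF x a])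
  have Y1: "1 - Y \<noteq> 0" unfolding Y_def by (rule l2_inner_ball[OF a y])
  define w where "w = (\<lambda>j. (x j - a j) + (d * (X - (1 - s\<^sup>2))) * a j)"
  define v where "v = (\<lambda>j. (y j - a j) + (d * (cnj Y - (1 - s\<^sup>2))) * a j)"
  have bx: "blaschke J a x = (\<lambda>j. s / (1 - X) * w j)"
    unfolding blaschke_eq[OF a l2(2)] \<sigma>_def[symmetric] aa X_def[symmetric] w_def d_def s_def by simp
  have by': "blaschke J a y = (\<lambda>j. s / (1 - cnj Y) * v j)"
    unfolding blaschke_eq[OF a l2(3)] \<sigma>_def[symmetric] aa Yc v_def d_def s_def by simp
  have xa: "(\<lambda>j. x j - a j) \<in> l2 J" "(\<lambda>j. y j - a j) \<in> l2 J" by (intro l2_diff l2)+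
  have sa: "(\<lambda>j. \<mu> * a j) \<in> l2 J" for \<mu> by (intro l2_scale l2)
  have vl2: "v \<in> l2 J" unfolding v_def by (intro l2_add xa sa)
  have av: "l2_inner J a v = (Y - (1 - s\<^sup>2)) * (1 + d * (1 - s\<^sup>2))"
    unfolding v_def l2_inner_add_right[OF xa(2) sa l2(1)] l2_inner_diff_right[OF l2(3,1,1)]
      l2_inner_scale_right aa Y_def[symmetric] using cd s(3) by (simp add: algebra_simps)
  have xv: "l2_inner J x v = Z - X + d * (Y - (1 - s\<^sup>2)) * X"
    unfolding v_def l2_inner_add_right[OF xa(2) sa l2(2)] l2_inner_diff_right[OF l2(3,1,2)]
      l2_inner_scale_right X_def[symmetric] Z_def[symmetric] using cd s(3) by (simp add: algebra_simps)
  have "l2_inner J w v = l2_inner J x v - l2_inner J a v + d * (X - (1 - s\<^sup>2)) * l2_inner J a v"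
    unfolding w_def l2_inner_add_left[OF xa(1) sa vl2] l2_inner_diff_left[OF l2(2,1) vl2]
      l2_inner_scale_left by simp
  then have wv: "l2_inner J w v = (Z - X - (Y - (1 - s\<^sup>2))) +
      (X - (1 - s\<^sup>2)) * (Y - (1 - s\<^sup>2)) * (2 * d + d\<^sup>2 * (1 - s\<^sup>2))"
    unfolding av xv by (simp add: algebra_simps power2_eq_square)
  have "s\<^sup>2 * (2 * d + d\<^sup>2 * (1 - s\<^sup>2)) = 1"
  proof -
    have "(1 + s) * (s\<^sup>2 * (2 * d + d\<^sup>2 * (1 - s\<^sup>2))) = (s * (1 + s) * d) * (2 * s) + (s * (1 + s) * d)\<^sup>2 * (1 - s)"
      by (simp add: algebra_simps power2_eq_square)
    also have "s * (1 + s) * d = 1" using s by (simp add: d_def)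
    finally have "(1 + s) * (s\<^sup>2 * (2 * d + d\<^sup>2 * (1 - s\<^sup>2))) = (1 + s) * 1" by simp
    then show ?thesis using s(2) by (simp only: mult_left_cancel simp_thms)
  qed
  moreover have "s\<^sup>2 * (p + q * k) = s\<^sup>2 * p + q * (s\<^sup>2 * k)" for p q k
    by (simp add: algebra_simps)
  ultimately have "s\<^sup>2 * l2_inner J w v = s\<^sup>2 * (Z - X - (Y - (1 - s\<^sup>2))) + (X - (1 - s\<^sup>2)) * (Y - (1 - s\<^sup>2))"
    unfolding wv by simp
  also have "\<dots> = (1 - X) * (1 - Y) - s\<^sup>2 * (1 - Z)"
    by (simp add: algebra_simps power2_eq_square)
  finally have "s\<^sup>2 * l2_inner J w v = (1 - X) * (1 - Y) - s\<^sup>2 * (1 - Z)" .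
  moreover have "l2_inner J (blaschke J a x) (blaschke J a y) =
      s\<^sup>2 * l2_inner J w v / ((1 - X) * (1 - Y))"
    unfolding bx by' l2_inner_scale_left l2_inner_scale_right using s(3)
    by (simp add: power2_eq_square)
  ultimately have "l2_inner J (blaschke J a x) (blaschke J a y) =
      ((1 - X) * (1 - Y) - s\<^sup>2 * (1 - Z)) / ((1 - X) * (1 - Y))" by simp
  also have "\<dots> = 1 - s\<^sup>2 * (1 - Z) / ((1 - X) * (1 - Y))"
    using X1 Y1 by (simp add: diff_divide_distrib)
  also have "s\<^sup>2 = 1 - l2_inner J a a" by (simp add: aa)
  finally show ?thesis by (simp add: X_def Y_def Z_def)
qed

section \<open>One-point extension for the Drury-Arveson kernel\<close>

lemma drury_arveson_commute: "drury_arveson J y x = cnj (drury_arveson J x y)"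
  by (simp add: drury_arveson_def flip: l2_inner_commute)

lemma drury_arveson_self:
  assumes "x \<in> l2_ball J"
  shows "drury_arveson J x x = of_real (1 / (1 - (l2_norm J x)\<^sup>2))"
  using l2_ballD[OF assms] by (simp add: drury_arveson_def l2_inner_self)

text \<open>The Schur complement of the Drury-Arveson kernel at \<open>a\<close> is its product with the Gram
  kernel of the Blaschke factor.  This is the complete Nevanlinna-Pick property in the form in
  which it is used.\<close>

lemma drury_arveson_blaschke:
  assumes "a \<in> l2_ball J" "x \<in> l2_ball J" "y \<in> l2_ball J"
  shows "drury_arveson J x y * l2_inner J (blaschke J a x) (blaschke J a y) =
    drury_arveson J x y - drury_arveson J x a * drury_arveson J a y / drury_arveson J a a"
proof -
  have "1 / z * (1 - r * z / (p * q)) = 1 / z - 1 / p * (1 / q) / (1 / r)" if "z \<noteq> 0"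
    for z r p q :: complex
    using that by (simp add: right_diff_distrib)
  then show ?thesis
    unfolding blaschke_inner[OF assms] drury_arveson_def
    using l2_inner_ball(2)[OF assms(2,3)] by blast
qed

text \<open>The Pick kernel of tangential interpolation data: at the point \<open>x s\<close> of the ball, a column
  multiplier \<open>G\<close> is to satisfy \<open>u s * G (x s) = v s\<close>.\<close>

definition pick_kernel :: "'i set \<Rightarrow> 'p set \<Rightarrow> ('a \<Rightarrow> 'i \<Rightarrow> complex) \<Rightarrow> ('a \<Rightarrow> 'p \<Rightarrow> complex) \<Rightarrow>
    ('a \<Rightarrow> complex) \<Rightarrow> 'a \<Rightarrow> 'a \<Rightarrow> complex" where
  "pick_kernel J P x u v = (\<lambda>s t. (l2_inner P (u s) (u t) - v s * cnj (v t)) * drury_arveson J (x s) (x t))"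

lemma pick_kernel_hermitian: "pick_kernel J P x u v t s = cnj (pick_kernel J P x u v s t)"
  using l2_inner_commute[of P "u t" "u s"] drury_arveson_commute[of J "x t" "x s"]
  by (simp add: pick_kernel_def)

lemma psd_pick_kernel_iff:
  "psd A (pick_kernel J P x u v) \<longleftrightarrow>
    (\<forall>F c. finite F \<longrightarrow> F \<subseteq> A \<longrightarrow> 0 \<le> Re (hform F (pick_kernel J P x u v) c c))"
proof
  assume "\<forall>F c. finite F \<longrightarrow> F \<subseteq> A \<longrightarrow> 0 \<le> Re (hform F (pick_kernel J P x u v) c c)"
  then show "psd A (pick_kernel J P x u v)" by (intro psdI pick_kernel_hermitian) blast
qed (blast intro: psd_nonneg)

text \<open>A value for the new condition \<open>q\<close> can be chosen so that the Pick kernel stays positive.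
  The kernel is \<open>N - L L\<^sup>*\<close>, where \<open>L i = v i * g i\<close> and \<open>N\<close> does not involve \<open>v q\<close>, because the
  Blaschke factor at \<open>x q\<close>, and with it \<open>B\<close>, vanishes at \<open>x q\<close>.\<close>

lemma pick_extension_finite:
  assumes I: "finite I" "q \<notin> I"
    and x: "\<And>i. i \<in> insert q I \<Longrightarrow> x i \<in> l2_ball J"
    and u: "\<And>i. i \<in> insert q I \<Longrightarrow> u i \<in> l2 P"
    and K: "psd I (pick_kernel J P x u v)"
  shows "\<exists>w. psd (insert q I) (pick_kernel J P x u (v(q := w)))"
proof -
  let ?a = "drury_arveson J" and ?b = "blaschke J (x q)"
  define \<sigma> where "\<sigma> = sqrt (1 - (l2_norm J (x q))\<^sup>2)"
  have q: "x q \<in> l2_ball J" by (simp add: x)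
  have \<sigma>: "\<sigma> > 0" "\<sigma>\<^sup>2 = 1 - (l2_norm J (x q))\<^sup>2" using l2_ballD(3)[OF q] by (auto simp: \<sigma>_def)
  have aqq: "?a (x q) (x q) = 1 / (of_real \<sigma>)\<^sup>2"
    unfolding drury_arveson_self[OF q] \<sigma>(2)[symmetric] by simp
  define g where "g i = of_real \<sigma> * ?a (x i) (x q)" for i
  define B where "B i j = ?a (x i) (x j) * l2_inner J (?b (x i)) (?b (x j))" for i j
  have gB: "g i * cnj (g j) + B i j = ?a (x i) (x j)" if "i \<in> insert q I" "j \<in> insert q I" for i j
    unfolding g_def B_def drury_arveson_blaschke[OF q x[OF that(1)] x[OF that(2)]] aqq
    by (simp add: power2_eq_square flip: drury_arveson_commute[of J "x q" "x j"])
  have B0: "B q j = 0" "B j q = 0" for j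
    by (simp_all add: B_def blaschke_center[OF q] l2_inner_def)
  \<comment> \<open>the factor \<open>1\<close> is the constant kernel, which \<open>psd_mult_gram\<close> turns into the Gram kernel of \<open>u\<close>\<close>
  define N where "N i j = g i * cnj (g j) * (1 * l2_inner P (u i) (u j)) +
    (l2_inner P (u i) (u j) - v i * cnj (v j)) * B i j" for i j
  have N: "psd (insert q I) N"
    unfolding N_def
  proof (intro psd_add psd_scale psd_mult_gram psd_one u)
    have "psd I (\<lambda>i j. pick_kernel J P x u v i j * l2_inner J (?b (x i)) (?b (x j)))"
      by (intro psd_mult_gram K blaschke_l2[OF q] l2_ballD(1) x) auto
    then have "psd I (\<lambda>i j. (l2_inner P (u i) (u j) - v i * cnj (v j)) * B i j)"
      by (simp add: pick_kernel_def B_def mult.assoc)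
    then show "psd (insert q I) (\<lambda>i j. (l2_inner P (u i) (u j) - v i * cnj (v j)) * B i j)"
      by (rule psd_extend_zero) (auto simp: B0)
  qed
  define L where "L i = v i * g i" for i
  have "psd I (\<lambda>i j. N i j - L i * cnj (L j))"
  proof (rule psd_cong[OF K])
    fix i j assume "i \<in> I" "j \<in> I"
    then show "pick_kernel J P x u v i j = N i j - L i * cnj (L j)"
      unfolding pick_kernel_def N_def L_def
      by (subst gB[symmetric]) (auto simp: algebra_simps)
  qed
  from psd_rank_one_extension[OF I N this] obtain w
    where w: "psd (insert q I) (\<lambda>i j. N i j - (L(q := w)) i * cnj ((L(q := w)) j))" by blast
  define w' where "w' = w * of_real \<sigma>"
  define v' where "v' = v(q := w')"
  have gq: "of_real \<sigma> * g q = 1" using \<sigma>(1) by (simp add: g_def aqq power2_eq_square)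
  have L': "(L(q := w)) i = v' i * g i" for i
    using gq by (auto simp: L_def v'_def w'_def mult.assoc)
  have N': "N i j = g i * cnj (g j) * l2_inner P (u i) (u j) +
    (l2_inner P (u i) (u j) - v' i * cnj (v' j)) * B i j" for i j
    by (cases "i = q"; cases "j = q") (auto simp: N_def B0 v'_def)
  have "psd (insert q I) (pick_kernel J P x u v')"
  proof (rule psd_cong[OF w])
    fix i j assume ij: "i \<in> insert q I" "j \<in> insert q I"
    show "N i j - (L(q := w)) i * cnj ((L(q := w)) j) = pick_kernel J P x u v' i j"
      unfolding pick_kernel_def L' N' gB[OF ij, symmetric] by (simp add: algebra_simps)
  qed
  then show ?thesis unfolding v'_def by blast
qed

text \<open>For infinite data, the admissible values for finite subsets of the data form a family of
  closed subsets of a disc with the finite intersection property.\<close>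

lemma pick_extension:
  assumes "q \<notin> I"
    and x: "\<And>i. i \<in> insert q I \<Longrightarrow> x i \<in> l2_ball J"
    and u: "\<And>i. i \<in> insert q I \<Longrightarrow> u i \<in> l2 P"
    and K: "psd I (pick_kernel J P x u v)"
  shows "\<exists>w. psd (insert q I) (pick_kernel J P x u (v(q := w)))"
proof -
  define V where "V F = {w. psd (insert q F) (pick_kernel J P x u (v(q := w)))}" for F
  define \<F> where "\<F> = {F. finite F \<and> F \<subseteq> I}"
  have "cball 0 (l2_norm P (u q)) \<inter> (\<Inter>F\<in>\<F>. V F) \<noteq> {}"
  proof (rule compact_imp_fip_image)
    fix F
    have cont: "continuous_on UNIV (\<lambda>w. (v(q := w)) i)" for i
      by (cases "i = q") auto
    have "continuous_on UNIV (\<lambda>w. Re (hform G (pick_kernel J P x u (v(q := w))) c c))" for G c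
      unfolding hform_def pick_kernel_def by (intro continuous_intros cont)
    then have "closed {w. \<forall>G c. finite G \<longrightarrow> G \<subseteq> insert q F \<longrightarrow>
        0 \<le> Re (hform G (pick_kernel J P x u (v(q := w))) c c)}"
      by (intro closed_Collect_all closed_Collect_imp closed_Collect_le) auto
    also have "{w. \<forall>G c. finite G \<longrightarrow> G \<subseteq> insert q F \<longrightarrow>
        0 \<le> Re (hform G (pick_kernel J P x u (v(q := w))) c c)} = V F"
      unfolding V_def psd_pick_kernel_iff ..
    finally show "closed (V F)" .
  next
    fix \<G> assume \<G>: "finite \<G>" "\<G> \<subseteq> \<F>"
    then have fin: "finite (\<Union>\<G>)" "\<Union>\<G> \<subseteq> I" by (auto simp: \<F>_def)
    have "\<exists>w. psd (insert q (\<Union>\<G>)) (pick_kernel J P x u (v(q := w)))"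
    proof (rule pick_extension_finite[OF fin(1)])
      show "psd (\<Union>\<G>) (pick_kernel J P x u v)" by (rule psd_mono[OF K fin(2)])
    qed (use fin assms(1) x u in auto)
    then obtain w where w: "psd (insert q (\<Union>\<G>)) (pick_kernel J P x u (v(q := w)))" by blast
    have "w \<in> V F" if "F \<in> \<G>" for F
      unfolding V_def using that by (auto intro: psd_mono[OF w])
    moreover have "cmod w \<le> l2_norm P (u q)"
    proof -
      define r where "r = 1 / (1 - (l2_norm J (x q))\<^sup>2)"
      have r: "r > 0" using l2_ballD(3)[OF x[of q]] by (simp add: r_def)
      have "0 \<le> Re (hform {q} (pick_kernel J P x u (v(q := w))) (\<lambda>_. 1) (\<lambda>_. 1))"
        by (rule psd_nonneg[OF w]) auto
      also have "hform {q} (pick_kernel J P x u (v(q := w))) (\<lambda>_. 1) (\<lambda>_. 1) =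
          of_real (((l2_norm P (u q))\<^sup>2 - (cmod w)\<^sup>2) * r)"
        using u[of q] x[of q]
        by (simp add: hform_def pick_kernel_def l2_inner_self drury_arveson_self r_def
            complex_norm_square del: of_real_power)
      finally have "(cmod w)\<^sup>2 \<le> (l2_norm P (u q))\<^sup>2" using r by (simp add: zero_le_mult_iff)
      then show ?thesis by (rule power2_le_imp_le) simp
    qed
    ultimately show "cball 0 (l2_norm P (u q)) \<inter> (\<Inter>F\<in>\<G>. V F) \<noteq> {}" by auto
  qed simp
  then obtain w where w: "\<And>F. finite F \<Longrightarrow> F \<subseteq> I \<Longrightarrow> psd (insert q F) (pick_kernel J P x u (v(q := w)))"
    by (auto simp: \<F>_def V_def)
  have "psd (insert q I) (pick_kernel J P x u (v(q := w)))"
    unfolding psd_finite_iff[of "insert q I"]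
  proof (intro allI impI)
    fix F assume "finite F" "F \<subseteq> insert q I"
    then show "psd F (pick_kernel J P x u (v(q := w)))"
      by (intro psd_mono[OF w[of "F - {q}"]]) auto
  qed
  then show ?thesis by blast
qed

section \<open>Maximal interpolation data and their columns\<close>

text \<open>The Pick kernel on triples \<open>(y, u, v)\<close>, each read as the condition \<open>u * G y = v\<close>.  Sets of
  triples with a positive kernel are ordered by inclusion, and nothing requires in advance that \<open>v\<close>
  be determined by \<open>y\<close> and \<open>u\<close>.\<close>

definition triple_kernel :: "'i set \<Rightarrow> 'p set \<Rightarrow>
    ('i \<Rightarrow> complex) \<times> ('p \<Rightarrow> complex) \<times> complex \<Rightarrow> ('i \<Rightarrow> complex) \<times> ('p \<Rightarrow> complex) \<times> complex \<Rightarrow> complex" where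
  "triple_kernel J P = pick_kernel J P fst (fst \<circ> snd) (snd \<circ> snd)"

lemma triple_kernel_apply:
  "triple_kernel J P (x, u, v) (y, u', v') = (l2_inner P u u' - v * cnj v') * drury_arveson J x y"
  by (simp add: triple_kernel_def pick_kernel_def)

lemma maximal_pick_data:
  assumes R: "R \<subseteq> l2_ball J \<times> l2 P \<times> UNIV" "psd R (triple_kernel J P)"
  obtains M where "R \<subseteq> M" "M \<subseteq> l2_ball J \<times> l2 P \<times> UNIV" "psd M (triple_kernel J P)"
    "\<And>y u. y \<in> l2_ball J \<Longrightarrow> u \<in> l2 P \<Longrightarrow> \<exists>v. (y, u, v) \<in> M"
proof -
  let ?X = "l2_ball J \<times> l2 P \<times> UNIV" and ?K = "triple_kernel J P"
  define \<A> where "\<A> = {M. R \<subseteq> M \<and> M \<subseteq> ?X \<and> psd M ?K}"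
  have "\<exists>M\<in>\<A>. \<forall>X\<in>\<A>. M \<subseteq> X \<longrightarrow> X = M"
  proof (rule subset_Zorn_nonempty)
    show "\<A> \<noteq> {}" using R by (auto simp: \<A>_def)
  next
    fix \<C> assume \<C>: "\<C> \<noteq> {}" "subset.chain \<A> \<C>"
    then have sub: "\<C> \<subseteq> \<A>" by (simp add: subset.chain_def)
    have "psd (\<Union>\<C>) ?K"
      unfolding psd_finite_iff[of "\<Union>\<C>"]
    proof (intro allI impI)
      fix F assume "finite F" "F \<subseteq> \<Union>\<C>"
      then obtain M where "M \<in> \<C>" "F \<subseteq> M"
        using finite_subset_Union_chain[OF _ _ \<C>] by metis
      then show "psd F ?K" using sub by (auto simp: \<A>_def intro: psd_mono)
    qed
    then show "\<Union>\<C> \<in> \<A>" using sub \<C>(1) by (auto simp: \<A>_def)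
  qed
  then obtain M where M: "M \<in> \<A>" "\<And>X. X \<in> \<A> \<Longrightarrow> M \<subseteq> X \<Longrightarrow> X = M" by blast
  have total: "\<exists>v. (y, u, v) \<in> M" if y: "y \<in> l2_ball J" and u: "u \<in> l2 P" for y u
  proof (rule ccontr)
    assume no: "\<nexists>v. (y, u, v) \<in> M"
    \<comment> \<open>the last component is a placeholder, to be replaced by the value \<open>w\<close>\<close>
    define q :: "('a \<Rightarrow> complex) \<times> ('b \<Rightarrow> complex) \<times> complex" where "q = (y, u, 0)"
    have "\<exists>w. psd (insert q M) (pick_kernel J P fst (fst \<circ> snd) ((snd \<circ> snd)(q := w)))"
    proof (rule pick_extension)
      show "psd M (pick_kernel J P fst (fst \<circ> snd) (snd \<circ> snd))"
        using M(1) by (simp add: \<A>_def triple_kernel_def)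
    qed (use M(1) y u no in \<open>auto simp: \<A>_def q_def\<close>)
    then obtain w where w: "psd (insert q M) (pick_kernel J P fst (fst \<circ> snd) ((snd \<circ> snd)(q := w)))" ..
    define f where "f t = (if t \<in> M then t else q)" for t
    let ?t = "(y, u, w)"
    have "psd (insert ?t M) (\<lambda>s t. pick_kernel J P fst (fst \<circ> snd) ((snd \<circ> snd)(q := w)) (f s) (f t))"
      by (rule psd_reindex[OF w]) (auto simp: f_def)
    then have "psd (insert ?t M) ?K"
    proof (rule psd_cong)
      fix s t assume "s \<in> insert ?t M" "t \<in> insert ?t M"
      moreover have "fst (f s) = fst s \<and> fst (snd (f s)) = fst (snd s) \<and>
          ((snd \<circ> snd)(q := w)) (f s) = snd (snd s)" if "s \<in> insert ?t M" for s
        using that no by (auto simp: f_def q_def)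
      ultimately show "pick_kernel J P fst (fst \<circ> snd) ((snd \<circ> snd)(q := w)) (f s) (f t) = ?K s t"
        by (simp add: triple_kernel_def pick_kernel_def del: fun_upd_apply)
    qed
    then have "insert ?t M \<in> \<A>" using M(1) y u by (auto simp: \<A>_def)
    then show False using M(2) no by blast
  qed
  show thesis
    by (rule that[of M]) (use M(1) total in \<open>auto simp: \<A>_def\<close>)
qed

text \<open>Over a single point of the ball, positivity says that the values \<open>v\<close> depend on the vectors \<open>u\<close>
  in a linear and contractive way.\<close>

lemma triple_combination_bound:
  assumes M: "psd M (triple_kernel J P)" and y: "y \<in> l2_ball J"
    and A: "finite A" "\<And>k. k \<in> A \<Longrightarrow> (y, u k, v k) \<in> M" "\<And>k. k \<in> A \<Longrightarrow> u k \<in> l2 P"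
  shows "(cmod (\<Sum>k\<in>A. c k * v k))\<^sup>2 \<le> (l2_norm P (\<lambda>p. \<Sum>k\<in>A. c k * u k p))\<^sup>2"
proof -
  define r where "r = 1 / (1 - (l2_norm J y)\<^sup>2)"
  have r: "r > 0" using l2_ballD(3)[OF y] by (simp add: r_def)
  have "psd A (\<lambda>k l. triple_kernel J P (y, u k, v k) (y, u l, v l))"
    using A(2) by (intro psd_reindex[OF M]) auto
  then have "0 \<le> Re (hform A (\<lambda>k l. triple_kernel J P (y, u k, v k) (y, u l, v l)) c c)"
    using A(1) by (intro psd_nonneg) auto
  also have "hform A (\<lambda>k l. triple_kernel J P (y, u k, v k) (y, u l, v l)) c c =
      of_real r * hform A (\<lambda>k l. l2_inner P (u k) (u l) - v k * cnj (v l)) c c"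
    unfolding triple_kernel_apply drury_arveson_self[OF y] r_def[symmetric]
    by (simp add: hform_def sum_distrib_left mult_ac)
  also have "\<dots> = of_real (r * ((l2_norm P (\<lambda>p. \<Sum>k\<in>A. c k * u k p))\<^sup>2 - (cmod (\<Sum>k\<in>A. c k * v k))\<^sup>2))"
    unfolding hform_diff_kernel hform_rank_one using hform_gram[of A u P c, OF A(1,3)] by simp
  finally show ?thesis using r by (simp add: zero_le_mult_iff)
qed

text \<open>The values at a point of the ball are represented by the column of values at the unit
  vectors.\<close>

lemma triple_functional:
  assumes M: "psd M (triple_kernel J P)" and y: "y \<in> l2_ball J"
    and g: "\<And>p. p \<in> P \<Longrightarrow> (y, (\<lambda>i. mat_id P i p), g p) \<in> M" "\<And>p. p \<notin> P \<Longrightarrow> g p = 0"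
  shows "g \<in> l2 P"
    and "(y, u, v) \<in> M \<Longrightarrow> u \<in> l2 P \<Longrightarrow> ((\<lambda>p. u p * g p) has_sum v) P"
proof -
  have comb: "(\<Sum>p\<in>F. c p * mat_id P i p) = (if i \<in> F then c i else 0)"
    if "finite F" "F \<subseteq> P" for F c i
  proof -
    have "(\<Sum>p\<in>F. c p * mat_id P i p) = (\<Sum>p\<in>F. if i = p then c p else 0)"
      using that by (intro sum.cong refl) (auto simp: mat_id_def)
    then show ?thesis using that by simp
  qed
  show "g \<in> l2 P"
  proof (rule l2I_bounded)
    fix F assume F: "finite F" "F \<subseteq> P"
    have "(cmod (\<Sum>p\<in>F. cnj (g p) * g p))\<^sup>2 \<le>
        (l2_norm P (\<lambda>i. \<Sum>p\<in>F. cnj (g p) * mat_id P i p))\<^sup>2"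
      using F g(1) by (intro triple_combination_bound[OF M y]) auto
    also have "(\<lambda>i. \<Sum>p\<in>F. cnj (g p) * mat_id P i p) = (\<lambda>i. if i \<in> F then cnj (g i) else 0)"
      using comb[OF F] by auto
    also have "(l2_norm P \<dots>)\<^sup>2 = (\<Sum>i\<in>F. (cmod (if i \<in> F then cnj (g i) else 0))\<^sup>2)"
      using F by (intro l2_norm_finite_support) auto
    also have "\<dots> = (\<Sum>i\<in>F. (cmod (g i))\<^sup>2)" by (intro sum.cong) auto
    also have "(\<Sum>p\<in>F. cnj (g p) * g p) = of_real (\<Sum>i\<in>F. (cmod (g i))\<^sup>2)"
      by (simp add: complex_norm_square mult.commute del: of_real_power)
    finally show "(\<Sum>i\<in>F. (cmod (g i))\<^sup>2)\<^sup>2 \<le> 1 * (\<Sum>i\<in>F. (cmod (g i))\<^sup>2)"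
      by (simp only: norm_of_real power2_abs mult_1)
  qed (rule g)
  assume t: "(y, u, v) \<in> M" and u: "u \<in> l2 P"
  show "((\<lambda>p. u p * g p) has_sum v) P"
  proof (rule has_sum_l2_tail_bound[OF u])
    fix F assume F: "finite F" "F \<subseteq> P"
    \<comment> \<open>\<open>None\<close> stands for the triple of \<open>u\<close>, \<open>Some p\<close> for that of the \<open>p\<close>-th unit vector\<close>
    define A where "A = insert None (Some ` F)"
    define uu where "uu k = (case k of None \<Rightarrow> u | Some p \<Rightarrow> (\<lambda>i. mat_id P i p))" for k
    define vv where "vv k = (case k of None \<Rightarrow> v | Some p \<Rightarrow> g p)" for k
    define cc where "cc k = (case k of None \<Rightarrow> 1 | Some p \<Rightarrow> - u p)" for k
    have sumA: "(\<Sum>k\<in>A. h k) = h None + (\<Sum>p\<in>F. h (Some p))" for h :: "_ \<Rightarrow> complex"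
      unfolding A_def using F(1) by (subst sum.insert) (auto simp: sum.reindex)
    have "(cmod (\<Sum>k\<in>A. cc k * vv k))\<^sup>2 \<le> (l2_norm P (\<lambda>i. \<Sum>k\<in>A. cc k * uu k i))\<^sup>2"
      using F g(1) t u by (intro triple_combination_bound[OF M y]) (auto simp: A_def uu_def vv_def)
    also have "(\<Sum>k\<in>A. cc k * vv k) = v - (\<Sum>p\<in>F. u p * g p)"
      by (simp add: sumA cc_def vv_def sum_negf)
    also have "(\<lambda>i. \<Sum>k\<in>A. cc k * uu k i) = (\<lambda>i. if i \<in> F then 0 else u i)"
      using comb[OF F, of u] by (auto simp: sumA cc_def uu_def sum_negf)
    finally show "(cmod (v - (\<Sum>p\<in>F. u p * g p)))\<^sup>2 \<le>
        1 * (l2_norm P (\<lambda>i. if i \<in> F then 0 else u i))\<^sup>2" by simp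
  qed
qed

section \<open>Tangential interpolation\<close>

lemma column_bounded:
  assumes "g \<in> l2 P"
  shows "(\<lambda>p (_ :: unit). g p) \<in> bounded_ops P UNIV"
proof -
  have mv: "mat_vec UNIV (\<lambda>p (_ :: unit). g p) x = (\<lambda>p. x () * g p)" for x
    by (simp add: mat_vec_def UNIV_unit mult.commute)
  have "l2_norm UNIV x = cmod (x ())" for x :: "unit \<Rightarrow> complex"
    by (simp add: l2_norm_def UNIV_unit)
  then have "\<forall>x\<in>l2 UNIV. mat_vec UNIV (\<lambda>p (_ :: unit). g p) x \<in> l2 P \<and>
      l2_norm P (mat_vec UNIV (\<lambda>p (_ :: unit). g p) x) \<le> l2_norm P g * l2_norm UNIV x"
    unfolding mv l2_norm_scale using assms by (auto intro: l2_scale)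
  then show ?thesis using l2_eq_0[OF assms] by (auto simp: bounded_ops_def)
qed

text \<open>The quadratic form of one entry \<open>(I - g h\<^sup>*) k\<close> of the kernel in the definition of
  column multipliers.\<close>

lemma l2_inner_multiplier_kernel:
  assumes "g \<in> l2 P" "h \<in> l2 P" "x \<in> l2 P" "y \<in> l2 P"
  shows "l2_inner P (mat_vec P (\<lambda>i j. (mat_id P i j - g i * cnj (h j)) * k) x) y =
    (l2_inner P x y - l2_inner P g y * l2_inner P x h) * k"
proof -
  have "mat_vec P (\<lambda>i j. (mat_id P i j - g i * cnj (h j)) * k) x =
      (\<lambda>i. k * (x i - l2_inner P x h * g i))"
  proof
    fix i
    have "((\<lambda>j. mat_id P i j * x j) has_sum x i) P"
      using l2_eq_0[OF assms(3), of i] by (cases "i \<in> P")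
        (auto simp: mat_id_def intro!: has_sum_finite_neutralI[of "{i} \<inter> P"] split: if_splits)
    moreover have "((\<lambda>j. (- g i) * (x j * cnj (h j))) has_sum (- g i) * l2_inner P x h) P"
      by (intro has_sum_cmult_right l2_inner_has_sum assms)
    ultimately have "((\<lambda>j. mat_id P i j * x j + (- g i) * (x j * cnj (h j))) has_sum
        x i + (- g i) * l2_inner P x h) P" by (rule has_sum_add)
    then have "((\<lambda>j. k * (mat_id P i j * x j + (- g i) * (x j * cnj (h j)))) has_sum
        k * (x i + (- g i) * l2_inner P x h)) P" by (rule has_sum_cmult_right)
    then show "mat_vec P (\<lambda>i j. (mat_id P i j - g i * cnj (h j)) * k) x i =
        k * (x i - l2_inner P x h * g i)"
      unfolding mat_vec_def by (simp add: infsumI algebra_simps)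
  qed
  then have "l2_inner P (mat_vec P (\<lambda>i j. (mat_id P i j - g i * cnj (h j)) * k) x) y =
      k * l2_inner P (\<lambda>i. x i - l2_inner P x h * g i) y"
    by (simp only: l2_inner_scale_left)
  then show ?thesis
    unfolding l2_inner_diff_left[OF assms(3) l2_scale[OF assms(1)] assms(4)] l2_inner_scale_left
    by (simp add: mult_ac)
qed

lemma psd_hform_nonneg_Reals:
  assumes "psd I K" "finite F" "F \<subseteq> I"
  shows "hform F K c c \<in> \<real>\<^sub>\<ge>\<^sub>0"
proof -
  have "psd F K" using assms psd_mono by blast
  then have "hform F K c c = of_real (Re (hform F K c c))" by (rule hform_self_real)
  moreover have "0 \<le> Re (hform F K c c)" by (rule psd_nonneg[OF assms])
  ultimately show ?thesis by (metis nonneg_Reals_of_real_iff)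
qed

text \<open>Tangential interpolation by contractive column multipliers of the Drury-Arveson kernel.
  The multiplier property of \<open>G\<close> tested on vectors \<open>\<xi> z\<close> is positivity of the maximal data on
  the triples with row vectors \<open>cnj (\<xi> z)\<close>.\<close>

lemma tangential_interpolation:
  assumes x: "\<And>z. z \<in> \<Omega> \<Longrightarrow> x z \<in> l2_ball J" and u: "\<And>z. z \<in> \<Omega> \<Longrightarrow> u z \<in> l2 P"
    and K: "psd \<Omega> (pick_kernel J P x u v)"
  shows "\<exists>G \<in> schur_multipliers (l2_ball J) (drury_arveson J) P (UNIV :: unit set).
    \<forall>z\<in>\<Omega>. v z = (\<Sum>\<^sub>\<infinity>p\<in>P. u z p * G (x z) p ())"
proof -
  define h where "h z = (x z, u z, v z)" for z
  have "psd (h ` \<Omega>) (\<lambda>s t. pick_kernel J P x u v (inv_into \<Omega> h s) (inv_into \<Omega> h t))"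
    by (rule psd_reindex[OF K]) (auto intro: inv_into_into)
  then have R: "psd (h ` \<Omega>) (triple_kernel J P)"
  proof (rule psd_cong)
    fix s t assume "s \<in> h ` \<Omega>" "t \<in> h ` \<Omega>"
    then have "h (inv_into \<Omega> h s) = s" "h (inv_into \<Omega> h t) = t" by (auto intro: f_inv_into_f)
    then show "pick_kernel J P x u v (inv_into \<Omega> h s) (inv_into \<Omega> h t) = triple_kernel J P s t"
      by (metis (no_types) h_def triple_kernel_apply pick_kernel_def)
  qed
  have "h ` \<Omega> \<subseteq> l2_ball J \<times> l2 P \<times> UNIV" using x u by (auto simp: h_def)
  from maximal_pick_data[OF this R] obtain M where
    M: "h ` \<Omega> \<subseteq> M" "M \<subseteq> l2_ball J \<times> l2 P \<times> UNIV" "psd M (triple_kernel J P)"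
    "\<And>y u. y \<in> l2_ball J \<Longrightarrow> u \<in> l2 P \<Longrightarrow> \<exists>v. (y, u, v) \<in> M" by metis
  define g where "g y p = (if p \<in> P then SOME c. (y, (\<lambda>i. mat_id P i p), c) \<in> M else 0)" for y p
  have g: "(y, (\<lambda>i. mat_id P i p), g y p) \<in> M" if "y \<in> l2_ball J" "p \<in> P" for y p
    using someI_ex[OF M(4)[OF that(1) unit_l2]] that(2) by (simp add: g_def)
  have g0: "g y p = 0" if "p \<notin> P" for y p using that by (simp add: g_def)
  have gl2: "g y \<in> l2 P" if "y \<in> l2_ball J" for y
    using triple_functional(1)[OF M(3) that g[OF that] g0] .
  have gsum: "((\<lambda>p. u p * g y p) has_sum v) P" if "(y, u, v) \<in> M" for y u v
  proof -
    have yu: "y \<in> l2_ball J" "u \<in> l2 P" using that M(2) by auto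
    show ?thesis using triple_functional(2)[OF M(3) yu(1) g[OF yu(1)] g0 that yu(2)] .
  qed
  define G where "G = (\<lambda>y p (_ :: unit). g y p)"
  have "G \<in> schur_multipliers (l2_ball J) (drury_arveson J) P UNIV"
    unfolding schur_multipliers_def
  proof (intro CollectI conjI ballI)
    fix y assume "y \<in> l2_ball J"
    then show "G y \<in> bounded_ops P UNIV"
      using column_bounded[OF gl2] by (simp add: G_def)
  next
    show "positive_kernel (l2_ball J) P (\<lambda>z w i j.
       (mat_id P i j - mat_mult UNIV (G z) (mat_adj (G w)) i j) * drury_arveson J z w)"
      unfolding positive_kernel_def
    proof (intro allI impI)
      fix F and \<xi> :: "_ \<Rightarrow> _ \<Rightarrow> complex"
      assume F: "finite F" "F \<subseteq> l2_ball J" and \<xi>: "\<forall>z\<in>F. \<xi> z \<in> l2 P"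
      define f where "f z = (z, (\<lambda>p. cnj (\<xi> z p)), l2_inner P (g z) (\<xi> z))" for z
      have fM: "f z \<in> M" if "z \<in> F" for z
      proof -
        have z: "z \<in> l2_ball J" "\<xi> z \<in> l2 P" using F \<xi> that by auto
        then obtain c where c: "(z, (\<lambda>p. cnj (\<xi> z p)), c) \<in> M" using M(4) l2_cnj by blast
        have "((\<lambda>p. cnj (\<xi> z p) * g z p) has_sum c) P"
          by (rule gsum[OF c])
        then have "c = l2_inner P (g z) (\<xi> z)" by (simp add: l2_inner_def infsumI mult.commute)
        then show ?thesis using c by (simp add: f_def)
      qed
      have "psd F (\<lambda>z w. triple_kernel J P (f z) (f w))"
        using fM by (intro psd_reindex[OF M(3)]) auto
      then have "hform F (\<lambda>z w. triple_kernel J P (f z) (f w)) (\<lambda>_. 1) (\<lambda>_. 1) \<in> \<real>\<^sub>\<ge>\<^sub>0"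
        using F(1) by (intro psd_hform_nonneg_Reals) auto
      also have "hform F (\<lambda>z w. triple_kernel J P (f z) (f w)) (\<lambda>_. 1) (\<lambda>_. 1) =
        (\<Sum>z\<in>F. \<Sum>w\<in>F. l2_inner P (mat_vec P (\<lambda>i j. (mat_id P i j -
           mat_mult UNIV (G z) (mat_adj (G w)) i j) * drury_arveson J z w) (\<xi> w)) (\<xi> z))"
        unfolding hform_def
      proof (intro sum.cong refl)
        fix z w assume zw: "z \<in> F" "w \<in> F"
        then have l2: "g z \<in> l2 P" "g w \<in> l2 P" "\<xi> w \<in> l2 P" "\<xi> z \<in> l2 P"
          using F \<xi> gl2 by auto
        have GG: "mat_mult UNIV (G z) (mat_adj (G w)) i j = g z i * cnj (g w j)" for i j
          by (simp add: mat_mult_def mat_adj_def G_def UNIV_unit)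
        have "l2_inner P (\<lambda>p. cnj (\<xi> z p)) (\<lambda>p. cnj (\<xi> w p)) = l2_inner P (\<xi> w) (\<xi> z)"
          by (simp add: l2_inner_def mult.commute)
        then show "1 * cnj 1 * triple_kernel J P (f z) (f w) =
          l2_inner P (mat_vec P (\<lambda>i j. (mat_id P i j -
            mat_mult UNIV (G z) (mat_adj (G w)) i j) * drury_arveson J z w) (\<xi> w)) (\<xi> z)"
          unfolding GG l2_inner_multiplier_kernel[OF l2]
          by (simp add: f_def triple_kernel_apply l2_inner_commute[of P "\<xi> w" "g w"])
      qed
      finally show "(\<Sum>z\<in>F. \<Sum>w\<in>F. l2_inner P (mat_vec P (\<lambda>i j. (mat_id P i j -
           mat_mult UNIV (G z) (mat_adj (G w)) i j) * drury_arveson J z w) (\<xi> w)) (\<xi> z)) \<in> \<real>\<^sub>\<ge>\<^sub>0" .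
    qed
  qed
  moreover have "v z = (\<Sum>\<^sub>\<infinity>p\<in>P. u z p * G (x z) p ())" if z: "z \<in> \<Omega>" for z
  proof -
    have "(x z, u z, v z) \<in> M" using M(1) z by (auto simp: h_def)
    then have "((\<lambda>p. u z p * g (x z) p) has_sum v z) P"
      by (rule gsum)
    then show ?thesis by (simp add: G_def infsumI)
  qed
  ultimately show ?thesis by blast
qed

section \<open>Multipliers of complete Nevanlinna-Pick kernels\<close>

lemma scalar_multipliers_iff_psd:
  assumes k: "\<And>z w. z \<in> \<Omega> \<Longrightarrow> w \<in> \<Omega> \<Longrightarrow> k w z = cnj (k z w)"
  shows "S \<in> scalar_multipliers \<Omega> k \<longleftrightarrow> psd \<Omega> (\<lambda>z w. (1 - S z * cnj (S w)) * k z w)"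
proof -
  define K where "K z w = (1 - S z * cnj (S w)) * k z w" for z w
  have one: "(\<lambda>_. c) \<in> l2 (UNIV :: unit set)" for c
    by (simp add: l2_def UNIV_unit)
  have "(\<lambda>_ _. S z) \<in> bounded_ops (UNIV :: unit set) (UNIV :: unit set)" for z
    using column_bounded[OF one] by simp
  then have "S \<in> scalar_multipliers \<Omega> k \<longleftrightarrow> positive_kernel \<Omega> (UNIV :: unit set) (\<lambda>z w i j. K z w)"
    by (simp add: scalar_multipliers_def schur_multipliers_def mat_id_def mat_mult_def mat_adj_def
        UNIV_unit K_def)
  also have "\<dots> \<longleftrightarrow> (\<forall>F x. finite F \<longrightarrow> F \<subseteq> \<Omega> \<longrightarrow>
      hform F K (\<lambda>z. cnj (x z ())) (\<lambda>z. cnj (x z ())) \<in> \<real>\<^sub>\<ge>\<^sub>0)"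
    by (simp add: positive_kernel_def hform_def l2_def l2_inner_def mat_vec_def UNIV_unit mult_ac)
  also have "\<dots> \<longleftrightarrow> psd \<Omega> K"
  proof
    assume *: "\<forall>F x. finite F \<longrightarrow> F \<subseteq> \<Omega> \<longrightarrow>
      hform F K (\<lambda>z. cnj (x z ())) (\<lambda>z. cnj (x z ())) \<in> \<real>\<^sub>\<ge>\<^sub>0"
    show "psd \<Omega> K"
    proof (rule psdI)
      fix z w assume "z \<in> \<Omega>" "w \<in> \<Omega>"
      then show "K w z = cnj (K z w)" using k[of z w] by (simp add: K_def mult.commute)
    next
      fix F and c :: "_ \<Rightarrow> complex" assume "finite F" "F \<subseteq> \<Omega>"
      then show "0 \<le> Re (hform F K c c)"
        using *[rule_format, of F "\<lambda>z _. cnj (c z)"] by (simp add: complex_nonneg_Reals_iff)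
    qed
  qed (auto intro: psd_hform_nonneg_Reals)
  finally show ?thesis unfolding K_def .
qed

theorem theorem1:
  fixes D :: "'d set" and \<Omega> :: "('d \<Rightarrow> complex) set"
    and k :: "('d \<Rightarrow> complex) \<Rightarrow> ('d \<Rightarrow> complex) \<Rightarrow> complex"
    and J :: "'i set" and \<beta> :: "('d \<Rightarrow> complex) \<Rightarrow> 'i \<Rightarrow> complex"
    and \<delta> :: "('d \<Rightarrow> complex) \<Rightarrow> complex"
  assumes "l2_open D \<Omega>" and "\<Omega> \<subseteq> l2_ball D"
    and "cnp_kernel_with \<Omega> k J \<beta> \<delta>"
  shows "(\<forall>S. S \<in> scalar_multipliers \<Omega> k \<longleftrightarrow>
            (\<exists>G \<in> scalar_multipliers (l2_ball J) (drury_arveson J). \<forall>z\<in>\<Omega>. S z = G (\<beta> z))) \<and>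
         (\<forall>S \<in> scalar_multipliers \<Omega> k. \<forall>w\<^sub>0\<in>\<Omega>. S w\<^sub>0 = 0 \<longleftrightarrow>
            (\<exists>G\<^sub>1 \<in> schur_multipliers (l2_ball J) (drury_arveson J) J (UNIV :: unit set).
               \<forall>z\<in>\<Omega>. S z = (\<Sum>\<^sub>\<infinity>j\<in>J. blaschke J (\<beta> w\<^sub>0) (\<beta> z) j * G\<^sub>1 (\<beta> z) j ())))"
proof -
  let ?a = "drury_arveson J"
  have \<beta>: "\<And>z. z \<in> \<Omega> \<Longrightarrow> \<beta> z \<in> l2_ball J" and \<delta>: "\<And>z. z \<in> \<Omega> \<Longrightarrow> \<delta> z \<noteq> 0"
    and k: "\<And>z w. z \<in> \<Omega> \<Longrightarrow> w \<in> \<Omega> \<Longrightarrow> k z w = \<delta> z * cnj (\<delta> w) * ?a (\<beta> z) (\<beta> w)"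
    using assms(3) by (auto simp: cnp_kernel_with_def)
  have kherm: "k w z = cnj (k z w)" if "z \<in> \<Omega>" "w \<in> \<Omega>" for z w
    using k[OF that] k[OF that(2,1)] drury_arveson_commute[of J "\<beta> w" "\<beta> z"] by simp
  have iff: "S \<in> scalar_multipliers \<Omega> k \<longleftrightarrow> psd \<Omega> (\<lambda>z w. (1 - S z * cnj (S w)) * ?a (\<beta> z) (\<beta> w))" for S
  proof -
    have "S \<in> scalar_multipliers \<Omega> k \<longleftrightarrow> psd \<Omega> (\<lambda>z w. (1 - S z * cnj (S w)) * k z w)"
      by (rule scalar_multipliers_iff_psd) (rule kherm)
    also have "\<dots> \<longleftrightarrow> psd \<Omega> (\<lambda>z w. (1 - S z * cnj (S w)) * ?a (\<beta> z) (\<beta> w))"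
    proof
      assume "psd \<Omega> (\<lambda>z w. (1 - S z * cnj (S w)) * k z w)"
      from psd_scale[OF this, of "\<lambda>z. 1 / \<delta> z"]
      show "psd \<Omega> (\<lambda>z w. (1 - S z * cnj (S w)) * ?a (\<beta> z) (\<beta> w))"
        by (rule psd_cong) (simp add: k \<delta>)
    next
      assume "psd \<Omega> (\<lambda>z w. (1 - S z * cnj (S w)) * ?a (\<beta> z) (\<beta> w))"
      from psd_scale[OF this, of \<delta>]
      show "psd \<Omega> (\<lambda>z w. (1 - S z * cnj (S w)) * k z w)"
        by (rule psd_cong) (simp add: k)
    qed
    finally show ?thesis .
  qed
  have iffG: "G \<in> scalar_multipliers (l2_ball J) ?a \<longleftrightarrow>
      psd (l2_ball J) (\<lambda>x y. (1 - G x * cnj (G y)) * ?a x y)" for G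
    by (rule scalar_multipliers_iff_psd) (rule drury_arveson_commute)
  have composition: "S \<in> scalar_multipliers \<Omega> k \<longleftrightarrow>
      (\<exists>G \<in> scalar_multipliers (l2_ball J) ?a. \<forall>z\<in>\<Omega>. S z = G (\<beta> z))" for S
  proof
    assume "S \<in> scalar_multipliers \<Omega> k"
    then have "psd \<Omega> (pick_kernel J (UNIV :: unit set) \<beta> (\<lambda>_ _. 1) S)"
      by (simp add: iff pick_kernel_def l2_inner_def UNIV_unit)
    moreover have "(\<lambda>_. 1) \<in> l2 (UNIV :: unit set)" by (simp add: l2_def UNIV_unit)
    ultimately have "\<exists>G \<in> schur_multipliers (l2_ball J) ?a (UNIV :: unit set) (UNIV :: unit set).
        \<forall>z\<in>\<Omega>. S z = (\<Sum>\<^sub>\<infinity>p\<in>UNIV. 1 * G (\<beta> z) p ())"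
      by (intro tangential_interpolation[where u = "\<lambda>_ _. 1"] \<beta>)
    then obtain G where
      G: "G \<in> schur_multipliers (l2_ball J) ?a (UNIV :: unit set) (UNIV :: unit set)"
        "\<forall>z\<in>\<Omega>. S z = (\<Sum>\<^sub>\<infinity>p\<in>UNIV. 1 * G (\<beta> z) p ())" by blast
    have "(\<lambda>z _ _. G z () ()) = G" by (intro ext) simp
    then have "(\<lambda>x. G x () ()) \<in> scalar_multipliers (l2_ball J) ?a"
      using G(1) by (simp add: scalar_multipliers_def)
    moreover have "\<forall>z\<in>\<Omega>. S z = G (\<beta> z) () ()" using G(2) by (simp add: UNIV_unit)
    ultimately show "\<exists>G \<in> scalar_multipliers (l2_ball J) ?a. \<forall>z\<in>\<Omega>. S z = G (\<beta> z)"
      by (intro bexI[of _ "\<lambda>x. G x () ()"])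
  next
    assume "\<exists>G \<in> scalar_multipliers (l2_ball J) ?a. \<forall>z\<in>\<Omega>. S z = G (\<beta> z)"
    then obtain G where "G \<in> scalar_multipliers (l2_ball J) ?a" and SG: "\<And>z. z \<in> \<Omega> \<Longrightarrow> S z = G (\<beta> z)"
      by blast
    then have G: "psd (l2_ball J) (\<lambda>x y. (1 - G x * cnj (G y)) * ?a x y)" by (simp only: iffG)
    have "psd \<Omega> (\<lambda>z w. (1 - G (\<beta> z) * cnj (G (\<beta> w))) * ?a (\<beta> z) (\<beta> w))"
      using \<beta> by (intro psd_reindex[OF G]) auto
    then show "S \<in> scalar_multipliers \<Omega> k"
      unfolding iff by (rule psd_cong) (simp add: SG)
  qed
  have factorization: "S w\<^sub>0 = 0 \<longleftrightarrow> (\<exists>G\<^sub>1 \<in> schur_multipliers (l2_ball J) ?a J (UNIV :: unit set).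
      \<forall>z\<in>\<Omega>. S z = (\<Sum>\<^sub>\<infinity>j\<in>J. blaschke J (\<beta> w\<^sub>0) (\<beta> z) j * G\<^sub>1 (\<beta> z) j ()))"
    if S: "S \<in> scalar_multipliers \<Omega> k" and w: "w\<^sub>0 \<in> \<Omega>" for S w\<^sub>0
  proof
    note \<beta>w = \<beta>[OF w]
    assume S0: "S w\<^sub>0 = 0"
    define K where "K z w = (1 - S z * cnj (S w)) * ?a (\<beta> z) (\<beta> w)" for z w
    have K: "psd \<Omega> K" using S unfolding iff K_def .
    have "K w\<^sub>0 w\<^sub>0 \<noteq> 0"
      using S0 l2_inner_ball(2)[OF \<beta>w \<beta>w] by (simp add: K_def drury_arveson_def)
    from psd_schur_complement[OF K, OF w this]
    have "psd \<Omega> (pick_kernel J J \<beta> (\<lambda>z. blaschke J (\<beta> w\<^sub>0) (\<beta> z)) S)"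
    proof (rule psd_cong)
      fix z w assume "z \<in> \<Omega>" "w \<in> \<Omega>"
      from drury_arveson_blaschke[OF \<beta>w \<beta>[OF this(1)] \<beta>[OF this(2)]]
      show "K z w - K z w\<^sub>0 * K w\<^sub>0 w / K w\<^sub>0 w\<^sub>0 =
          pick_kernel J J \<beta> (\<lambda>z. blaschke J (\<beta> w\<^sub>0) (\<beta> z)) S z w"
        using S0 by (simp add: K_def pick_kernel_def algebra_simps)
    qed
    then show "\<exists>G\<^sub>1 \<in> schur_multipliers (l2_ball J) ?a J (UNIV :: unit set).
      \<forall>z\<in>\<Omega>. S z = (\<Sum>\<^sub>\<infinity>j\<in>J. blaschke J (\<beta> w\<^sub>0) (\<beta> z) j * G\<^sub>1 (\<beta> z) j ())"
      by (intro tangential_interpolation[of \<Omega> \<beta> J "\<lambda>z. blaschke J (\<beta> w\<^sub>0) (\<beta> z)"] \<beta>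
          blaschke_l2[OF \<beta>w] l2_ballD(1))
  next
    assume "\<exists>G\<^sub>1 \<in> schur_multipliers (l2_ball J) ?a J (UNIV :: unit set).
      \<forall>z\<in>\<Omega>. S z = (\<Sum>\<^sub>\<infinity>j\<in>J. blaschke J (\<beta> w\<^sub>0) (\<beta> z) j * G\<^sub>1 (\<beta> z) j ())"
    then obtain G\<^sub>1 where "S w\<^sub>0 = (\<Sum>\<^sub>\<infinity>j\<in>J. blaschke J (\<beta> w\<^sub>0) (\<beta> w\<^sub>0) j * G\<^sub>1 (\<beta> w\<^sub>0) j ())"
      using w by blast
    then show "S w\<^sub>0 = 0" by (simp add: blaschke_center[OF \<beta>[OF w]])
  qed
  show ?thesis using composition factorization by blast
qed

end
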